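(* Suppose that the coefficients $b,\sigma,q,\phi$ satisfy Hypothesis (H) (stated in the context), and let $v\in C^{1,2}_p(\Lambda)$. Then $v$ is a classical solution (resp. classical subsolution, classical supersolution) of the path-dependent Hamilton–Jacobi–Bellman (PHJB) equation $$\begin{cases}\partial_tV(\gamma_t)+\mathbf H(\gamma_t,V(\gamma_t),\partial_xV(\gamma_t),\partial_{xx}V(\gamma_t))=0,&(t,\gamma_t)\in[0,T)\times\Lambda,\\ V(\gamma_T)=\phi(\gamma_T),&\gamma_T\in\Lambda_T,\end{cases}$$ if and only if it is a viscosity solution (resp. viscosity subsolution, viscosity supersolution) of it.
   Context: **Path spaces.** Fix $T>0$ and positive integers $d,n$. $|\cdot|$ is the Euclidean norm, $|A|_2$ the Hilbert–Schmidt norm of a matrix, $\mathcal S(\mathbb R^d)$ the symmetric $d\times d$ matrices. For $t\in[0,T]$ let $\hat\Lambda_t$ be the set of càdlàg functions $[0,t]\to\mathbb R^d$ and $\Lambda_t=C([0,t];\mathbb R^d)$; $\hat\Lambda^t=\bigcup_{s\in[t,T]}\hat\Lambda_s$, $\Lambda^t=\bigcup_{s\in[t,T]}\Lambda_s$, $\hat\Lambda=\hat\Lambda^0$, $\Lambda=\Lambda^0$. An element of $\hat\Lambda_t$ is written $\gamma_t$ (the subscript is the final time), its value at $s$ is $\gamma_t(s)$; writing $(t,\gamma_t)\in[0,T]\times\Lambda$ always means $\gamma_t\in\Lambda_t$. For $t\le\bar t$, $\gamma_{t,\bar t}\in\hat\Lambda_{\bar t}$ equals $\gamma_t$ on $[0,t)$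 and $\gamma_t(t)$ on $[t,\bar t]$. For $x\in\mathbb R^d$, $\gamma_t^x$ equals $\gamma_t$ on $[0,t)$ and $\gamma_t(t)+x$ at time $t$. $\|\gamma_t\|_0=\sup_{0\le s\le t}|\gamma_t(s)|$, $\|\gamma_t-\eta_s\|_0:=\|\gamma_{t,t\vee s}-\eta_{s,t\vee s}\|_0$, $d_\infty(\gamma_t,\eta_s)=|t-s|+\|\gamma_t-\eta_s\|_0$. **Pathwise derivatives.** For $f$ on $\hat\Lambda^t$: $\partial_{x_i}f(\gamma_s)=\lim_{h\to0}\frac1h[f(\gamma_s^{he_i})-f(\gamma_s)]$, $\partial_{x_ix_j}f=\partial_{x_i}(\partial_{x_j}f)$, $\partial_tf(\gamma_s)=\lim_{h\downarrow0}\frac1h[f(\gamma_{s,s+h})-f(\gamma_s)]$ for $s<T$, and $\partial_tf(\gamma_T)=\lim_{s\uparrow T}\partial_tf(\gamma_T|_{[0,s]})$. $\partial_xf$ is a column vector, $\partial_{xx}f$ a $d\times d$ matrix. For $t\in[0,T)$: $C^0(\hat\Lambda^t)$ is the set of $d_\infty$-continuous functionals; $C^{1,2}_p(\hat\Lambda^t)$ is the set of $f\in C^0(\hat\Lambda^t)$ such that $\partial_tf,\partial_{x_i}f,\partial_{x_ix_j}f$ exist on $\hat\Lambda^t$, belong to $C^0(\hat\Lambda^t)$, and $f$ and all these derivatives have polynomial growth in $\|\cdot\|_0$. $C^0(\Lambda^t)$, $USC^0(\Lambda^t)$, $LSC^0(\Lambda^t)$ are the functionals on $\Lambda^t$ that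 are continuous, upper, lower semicontinuous under $d_\infty$. $f\in C^{1,2}_p(\Lambda^t)$ if $f$ is the restriction to $\Lambda^t$ of some $\hat f\in C^{1,2}_p(\hat\Lambda^t)$; then $\partial_tf,\partial_xf,\partial_{xx}f$ on $\Lambda^t$ are those of $\hat f$ (independent of the choice of $\hat f$). **Coefficients.** $(U,d_1)$ is a Polish space; $b:\Lambda\times U\to\mathbb R^d$, $\sigma:\Lambda\times U\to\mathbb R^{d\times n}$, $q:\Lambda\times\mathbb R\times\mathbb R^n\times U\to\mathbb R$, $\phi:\Lambda_T\to\mathbb R$. *Hypothesis (H):* $b,\sigma,q,\phi$ are continuous and there is $L>0$ such that for all $t\in[0,T]$, $\gamma_t,\gamma_t'\in\Lambda_t$, $\eta_T,\eta_T'\in\Lambda_T$, $y,y'\in\mathbb R$, $z,z'\in\mathbb R^n$, $u\in U$: $|b(\gamma_t,u)|^2\vee|\sigma(\gamma_t,u)|_2^2\le L^2(1+\|\gamma_t\|_0^2)$; $|b(\gamma_t,u)-b(\gamma_t',u)|\vee|\sigma(\gamma_t,u)-\sigma(\gamma_t',u)|_2\le L\|\gamma_t-\gamma_t'\|_0$; $|q(\gamma_t,y,z,u)|\le L(1+\|\gamma_t\|_0+|y|+|z|)$; $|q(\gamma_t,y,z,u)-q(\gamma_t',y',z',u)|\le L(\|\gamma_t-\gamma_t'\|_0+|y-y'|+|z-z'|)$; $|\phi(\eta_T)-\phi(\eta_T')|\le L\|\eta_T-\eta_T'\|_0$. **Hamiltonian.** $\mathbf H(\gamma_t,r,p,\iota)=\sup_{u\in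 U}\big[\langle p,b(\gamma_t,u)\rangle+\frac12\mathrm{tr}(\iota\,\sigma(\gamma_t,u)\sigma^\top(\gamma_t,u))+q(\gamma_t,r,\sigma^\top(\gamma_t,u)p,u)\big]$ for $(t,\gamma_t,r,p,\iota)\in[0,T]\times\Lambda\times\mathbb R\times\mathbb R^d\times\mathcal S(\mathbb R^d)$, and $\mathcal L\varphi(\gamma_t)=\partial_t\varphi(\gamma_t)+\mathbf H(\gamma_t,\varphi(\gamma_t),\partial_x\varphi(\gamma_t),\partial_{xx}\varphi(\gamma_t))$. **Classical solutions.** $v\in C^{1,2}_p(\Lambda)$ is a classical solution (resp. subsolution, supersolution) if $v(\gamma_T)=\phi(\gamma_T)$ (resp. $\le$, $\ge$) for all $\gamma_T\in\Lambda_T$ and $\mathcal Lv(\gamma_t)=0$ (resp. $\ge0$, $\le0$) for all $(t,\gamma_t)\in[0,T)\times\Lambda$. **Viscosity solutions.** For $w\in USC^0(\Lambda)$, $\mathcal A^+(\gamma_t,w)=\{\varphi\in C^{1,2}_p(\Lambda^t):0=(w-\varphi)(\gamma_t)=\sup_{\eta_s\in\Lambda^t}(w-\varphi)(\eta_s)\}$; for $w\in LSC^0(\Lambda)$, $\mathcal A^-(\gamma_t,w)$ is defined with $\inf$ instead of $\sup$. $w\in USC^0(\Lambda)$ (resp. $LSC^0(\Lambda)$) is a viscosity subsolution (resp. supersolution) of the PHJB equation if $w(\gamma_T)\le\phi(\gamma_T)$ (resp. $\ge$) for all $\gamma_T\in\Lambda_T$ and, whenever $\varphi\in\mathcal A^+(\gamma_s,w)$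 (resp. $\mathcal A^-(\gamma_s,w)$) with $(s,\gamma_s)\in[0,T)\times\Lambda$, one has $\mathcal L\varphi(\gamma_s)\ge0$ (resp. $\le0$). $w\in C^0(\Lambda)$ is a viscosity solution if it is both. *)

theory Defs
  imports "HOL-Analysis.Analysis"
begin

section \<open>Path space\<close>

definition cadlag_on :: "real \<Rightarrow> (real \<Rightarrow> 'a::topological_space) \<Rightarrow> bool" where
  "cadlag_on t f \<longleftrightarrow>
     (\<forall>s. 0 \<le> s \<and> s < t \<longrightarrow> (f \<longlongrightarrow> f s) (at_right s)) \<and>
     (\<forall>s. 0 < s \<and> s \<le> t \<longrightarrow> (\<exists>l. (f \<longlongrightarrow> l) (at_left s)))"

text \<open>
  An element \<open>\<gamma>\<^sub>t\<close> is a final time \<open>t\<close> together with a cadlag function on \<open>[0,t]\<close>;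
  outside \<open>[0,t]\<close> the function takes the value \<^const>\<open>undefined\<close>, so that two paths are
  equal iff they have the same final time and agree on \<open>[0,t]\<close>. The horizon \<open>T\<close> is imposed
  by the carrier sets below. Being a type, the space of all paths can carry
  the metric \<open>d\<^sub>\<infinity>\<close> as its \<^class>\<open>metric_space\<close> structure.
\<close>

typedef (overloaded) 'd path =
  "{(t, f :: real \<Rightarrow> real^'d::finite). 0 \<le> t \<and> f \<in> extensional {0..t} \<and> cadlag_on t f}"
proof
  show "(0, restrict (\<lambda>_. 0) {0..0}) \<in>
    {(t, f :: real \<Rightarrow> real^'d). 0 \<le> t \<and> f \<in> extensional {0..t} \<and> cadlag_on t f}"
    by (auto simp: cadlag_on_def)
qed

definition ptime :: "'d::finite path \<Rightarrow> real" where
  "ptime \<gamma> = fst (Rep_path \<gamma>)"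

definition pval :: "'d::finite path \<Rightarrow> real \<Rightarrow> real^'d" where
  "pval \<gamma> = snd (Rep_path \<gamma>)"

text \<open>\<open>mk_path t f\<close> is the restriction of \<open>f\<close> to \<open>[0,t]\<close>.\<close>

definition mk_path :: "real \<Rightarrow> (real \<Rightarrow> real^'d::finite) \<Rightarrow> 'd path" where
  "mk_path t f = Abs_path (t, restrict f {0..t})"

text \<open>\<open>\<gamma>\<^sub>t\<^sub>,\<^sub>r\<close>, meant for \<open>r \<ge> t\<close>.\<close>

definition prolong :: "real \<Rightarrow> 'd::finite path \<Rightarrow> 'd path" where
  "prolong r \<gamma> = mk_path r (\<lambda>s. if s < ptime \<gamma> then pval \<gamma> s else pval \<gamma> (ptime \<gamma>))"

text \<open>\<open>\<gamma>\<^sub>t\<^sup>x\<close>.\<close>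

definition bump :: "'d::finite path \<Rightarrow> real^'d \<Rightarrow> 'd path" where
  "bump \<gamma> x = mk_path (ptime \<gamma>)
     (\<lambda>s. if s < ptime \<gamma> then pval \<gamma> s else pval \<gamma> (ptime \<gamma>) + x)"

text \<open>The restriction of \<open>\<gamma>\<^sub>t\<close> to \<open>[0,s]\<close>, meant for \<open>0 \<le> s \<le> t\<close>.\<close>

definition cut :: "real \<Rightarrow> 'd::finite path \<Rightarrow> 'd path" where
  "cut s \<gamma> = mk_path s (pval \<gamma>)"

definition norm0 :: "'d::finite path \<Rightarrow> real" where
  "norm0 \<gamma> = (SUP s\<in>{0..ptime \<gamma>}. norm (pval \<gamma> s))"

definition dist0 :: "'d::finite path \<Rightarrow> 'd path \<Rightarrow> real" where
  "dist0 \<gamma> \<eta> = (let r = max (ptime \<gamma>) (ptime \<eta>) in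
     SUP s\<in>{0..r}. norm (pval (prolong r \<gamma>) s - pval (prolong r \<eta>) s))"

lemma ptime_nonneg: "0 \<le> ptime \<gamma>"
  and pval_extensional: "pval \<gamma> \<in> extensional {0..ptime \<gamma>}"
  and pval_cadlag: "cadlag_on (ptime \<gamma>) (pval \<gamma>)"
  using Rep_path[of \<gamma>] by (auto simp: ptime_def pval_def)

lemma path_eqI:
  assumes "ptime \<gamma> = ptime \<eta>" "\<And>s. 0 \<le> s \<Longrightarrow> s \<le> ptime \<gamma> \<Longrightarrow> pval \<gamma> s = pval \<eta> s"
  shows "\<gamma> = \<eta>"
proof -
  have "pval \<gamma> = pval \<eta>"
    by (rule extensionalityI[OF pval_extensional]) (use assms pval_extensional[of \<eta>] in auto)
  with assms(1) have "Rep_path \<gamma> = Rep_path \<eta>"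
    by (simp add: ptime_def pval_def prod_eq_iff)
  then show ?thesis by (simp add: Rep_path_inject)
qed

lemma cadlag_on_cong:
  assumes "cadlag_on t f" "\<And>s. 0 \<le> s \<Longrightarrow> s \<le> t \<Longrightarrow> f s = g s"
  shows "cadlag_on t g"
  unfolding cadlag_on_def
proof (intro conjI allI impI)
  fix s assume s: "0 \<le> s \<and> s < t"
  have "\<forall>\<^sub>F x in at_right s. f x = g x"
    using s assms(2) by (intro eventually_at_rightI[of s t]) auto
  moreover have "(f \<longlongrightarrow> f s) (at_right s)" using assms(1) s by (auto simp: cadlag_on_def)
  ultimately show "(g \<longlongrightarrow> g s) (at_right s)"
    using assms(2)[of s] s by (simp add: filterlim_cong)
next
  fix s assume s: "0 < s \<and> s \<le> t"
  have ev: "\<forall>\<^sub>F x in at_left s. f x = g x"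
    using s assms(2) by (intro eventually_at_leftI[of 0 s]) auto
  obtain l where "(f \<longlongrightarrow> l) (at_left s)" using assms(1) s by (auto simp: cadlag_on_def)
  then have "(g \<longlongrightarrow> l) (at_left s)" using ev by (simp add: filterlim_cong)
  then show "\<exists>l. (g \<longlongrightarrow> l) (at_left s)" ..
qed

lemma
  assumes "0 \<le> t" "cadlag_on t f"
  shows ptime_mk_path: "ptime (mk_path t f) = t"
    and pval_mk_path: "pval (mk_path t f) = restrict f {0..t}"
proof -
  have "cadlag_on t (restrict f {0..t})"
    by (rule cadlag_on_cong[OF assms(2)]) auto
  then have "Rep_path (mk_path t f) = (t, restrict f {0..t})"
    using assms(1) unfolding mk_path_def by (intro Abs_path_inverse) auto
  then show "ptime (mk_path t f) = t" "pval (mk_path t f) = restrict f {0..t}"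
    by (simp_all add: ptime_def pval_def)
qed

lemma cadlag_on_stop:
  assumes "cadlag_on t f" "0 \<le> t"
  shows "cadlag_on r (\<lambda>s. if s < t then f s else c)"
  unfolding cadlag_on_def
proof (intro conjI allI impI)
  fix s assume s: "0 \<le> s \<and> s < r"
  show "((\<lambda>s. if s < t then f s else c) \<longlongrightarrow> (if s < t then f s else c)) (at_right s)"
  proof (cases "s < t")
    case True
    have "\<forall>\<^sub>F x in at_right s. f x = (if x < t then f x else c)"
      using True by (intro eventually_at_rightI[of s t]) auto
    moreover have "(f \<longlongrightarrow> f s) (at_right s)"
      using assms True s by (auto simp: cadlag_on_def)
    ultimately have "((\<lambda>s. if s < t then f s else c) \<longlongrightarrow> f s) (at_right s)"
      using filterlim_cong by fast
    with True show ?thesis by simp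
  next
    case False
    have "\<forall>\<^sub>F x in at_right s. (if x < t then f x else c) = c"
      using False by (intro eventually_at_rightI[of s "s+1"]) auto
    then show ?thesis using False by (auto intro: tendsto_eventually)
  qed
next
  fix s assume s: "0 < s \<and> s \<le> r"
  show "\<exists>l. ((\<lambda>s. if s < t then f s else c) \<longlongrightarrow> l) (at_left s)"
  proof (cases "s \<le> t")
    case True
    have "\<forall>\<^sub>F x in at_left s. f x = (if x < t then f x else c)"
      using True s by (intro eventually_at_leftI[of 0 s]) auto
    moreover obtain l where "(f \<longlongrightarrow> l) (at_left s)"
      using assms True s by (auto simp: cadlag_on_def)
    ultimately have "((\<lambda>s. if s < t then f s else c) \<longlongrightarrow> l) (at_left s)"
      using filterlim_cong by fast
    then show ?thesis ..
  next
    case False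
    have "\<forall>\<^sub>F x in at_left s. (if x < t then f x else c) = c"
      using False by (intro eventually_at_leftI[of t s]) auto
    then show ?thesis by (auto intro: tendsto_eventually)
  qed
qed

lemma
  assumes "ptime \<gamma> \<le> r"
  shows ptime_prolong: "ptime (prolong r \<gamma>) = r"
    and pval_prolong: "0 \<le> s \<Longrightarrow> s \<le> r \<Longrightarrow> pval (prolong r \<gamma>) s = pval \<gamma> (min s (ptime \<gamma>))"
proof -
  have *: "0 \<le> r" using assms ptime_nonneg[of \<gamma>] by simp
  note ** = cadlag_on_stop[OF pval_cadlag ptime_nonneg, of r \<gamma>]
  show "ptime (prolong r \<gamma>) = r"
    unfolding prolong_def by (rule ptime_mk_path[OF * **])
  show "pval (prolong r \<gamma>) s = pval \<gamma> (min s (ptime \<gamma>))" if "0 \<le> s" "s \<le> r"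
    unfolding prolong_def using that by (simp add: pval_mk_path[OF * **] min_def)
qed

lemma
  shows ptime_bump: "ptime (bump \<gamma> x) = ptime \<gamma>"
    and pval_bump: "0 \<le> s \<Longrightarrow> s \<le> ptime \<gamma> \<Longrightarrow>
          pval (bump \<gamma> x) s = (if s < ptime \<gamma> then pval \<gamma> s else pval \<gamma> (ptime \<gamma>) + x)"
  unfolding bump_def
  by (simp_all add: ptime_mk_path pval_mk_path ptime_nonneg cadlag_on_stop pval_cadlag)

lemma
  assumes "0 \<le> s" "s \<le> ptime \<gamma>"
  shows ptime_cut: "ptime (cut s \<gamma>) = s"
    and pval_cut: "pval (cut s \<gamma>) = restrict (pval \<gamma>) {0..s}"
proof -
  have "cadlag_on s (pval \<gamma>)" using pval_cadlag[of \<gamma>] assms by (auto simp: cadlag_on_def)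
  then show "ptime (cut s \<gamma>) = s" "pval (cut s \<gamma>) = restrict (pval \<gamma>) {0..s}"
    unfolding cut_def by (simp_all add: ptime_mk_path pval_mk_path assms)
qed

lemma cadlag_on_bounded:
  fixes f :: "real \<Rightarrow> 'a::real_normed_vector"
  assumes "0 \<le> t" "cadlag_on t f"
  shows "bounded (f ` {0..t})"
proof -
  define I where "I = {0..t}"
  let ?P = "\<lambda>a b. bounded (f ` ({a..b} \<inter> I))"
  have "?P 0 t" using assms(1)
  proof (induction rule: Bolzano)
    case (trans a b c)
    have "f ` ({a..c} \<inter> I) \<subseteq> f ` ({a..b} \<inter> I) \<union> f ` ({b..c} \<inter> I)" by force
    then show ?case using trans bounded_Un bounded_subset by metis
  next
    case (local x)
    have R: "\<exists>d>0. \<exists>K. \<forall>y. x < y \<and> y < x + d \<and> y \<le> t \<longrightarrow> norm (f y) \<le> K"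
    proof (cases "x < t")
      case True
      then have "(f \<longlongrightarrow> f x) (at_right x)" using assms local by (auto simp: cadlag_on_def)
      then have "\<forall>\<^sub>F y in at_right x. dist (f y) (f x) < 1" by (rule tendstoD) simp
      then obtain b where "b > x" and b: "\<And>y. x < y \<Longrightarrow> y < b \<Longrightarrow> dist (f y) (f x) < 1"
        by (auto simp: eventually_at_right_field)
      have "norm (f y) \<le> norm (f x) + 1" if "x < y" "y < b" for y
        using b[OF that] norm_triangle_sub[of "f y" "f x"] by (simp add: dist_norm)
      then show ?thesis using \<open>b > x\<close> by (intro exI[of _ "b - x"]) auto
    next
      case False
      then show ?thesis by (intro exI[of _ 1]) auto
    qed
    have L: "\<exists>d>0. \<exists>K. \<forall>y. x - d < y \<and> y < x \<and> 0 \<le> y \<longrightarrow> norm (f y) \<le> K"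
    proof (cases "0 < x")
      case True
      then obtain l where "(f \<longlongrightarrow> l) (at_left x)" using assms local by (auto simp: cadlag_on_def)
      then have "\<forall>\<^sub>F y in at_left x. dist (f y) l < 1" by (rule tendstoD) simp
      then obtain b where "b < x" and b: "\<And>y. b < y \<Longrightarrow> y < x \<Longrightarrow> dist (f y) l < 1"
        by (auto simp: eventually_at_left_field)
      have "norm (f y) \<le> norm l + 1" if "b < y" "y < x" for y
        using b[OF that] norm_triangle_sub[of "f y" l] by (simp add: dist_norm)
      then show ?thesis using \<open>b < x\<close> by (intro exI[of _ "x - b"]) auto
    next
      case False
      then show ?thesis by (intro exI[of _ 1]) auto
    qed
    obtain d1 K1 d2 K2 where d: "d1 > 0" "d2 > 0"
      and K1: "\<And>y. x < y \<Longrightarrow> y < x + d1 \<Longrightarrow> y \<le> t \<Longrightarrow> norm (f y) \<le> K1"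
      and K2: "\<And>y. x - d2 < y \<Longrightarrow> y < x \<Longrightarrow> 0 \<le> y \<Longrightarrow> norm (f y) \<le> K2"
      using R L by blast
    show ?case
    proof (intro exI[of _ "min d1 d2"] conjI allI impI)
      show "min d1 d2 > 0" using d by simp
      fix a b assume ab: "a \<le> x \<and> x \<le> b \<and> b - a < min d1 d2"
      show "?P a b"
        unfolding bounded_iff
      proof (intro exI[of _ "max (norm (f x)) (max K1 K2)"] ballI)
        fix z assume "z \<in> f ` ({a..b} \<inter> I)"
        then obtain y where y: "z = f y" "a \<le> y" "y \<le> b" "0 \<le> y" "y \<le> t"
          by (auto simp: I_def)
        then show "norm z \<le> max (norm (f x)) (max K1 K2)"
          using K1[of y] K2[of y] ab by (cases y x rule: linorder_cases) auto
      qed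
    qed
  qed
  then show ?thesis by (simp add: I_def)
qed

lemma bounded_pval: "bounded (pval \<gamma> ` {0..ptime \<gamma>})"
  by (rule cadlag_on_bounded[OF ptime_nonneg pval_cadlag])

lemma bdd_above_pval: "bdd_above ((\<lambda>s. norm (pval \<gamma> s)) ` {0..ptime \<gamma>})"
  using bounded_pval[of \<gamma>] by (auto simp: bounded_iff bdd_above_def)

lemma dist0_eq:
  assumes "max (ptime \<gamma>) (ptime \<eta>) = r"
  shows "dist0 \<gamma> \<eta> = (SUP s\<in>{0..r}. norm (pval \<gamma> (min s (ptime \<gamma>)) - pval \<eta> (min s (ptime \<eta>))))"
  using assms by (auto simp: dist0_def Let_def pval_prolong intro!: SUP_cong)

lemma bdd_above_dist0:
  "bdd_above ((\<lambda>s. norm (pval \<gamma> (min s (ptime \<gamma>)) - pval \<eta> (min s (ptime \<eta>)))) ` {0..r})"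
proof -
  obtain A where A: "\<And>s. 0 \<le> s \<Longrightarrow> s \<le> ptime \<gamma> \<Longrightarrow> norm (pval \<gamma> s) \<le> A"
    using bounded_pval[of \<gamma>] unfolding bounded_iff by fastforce
  obtain B where B: "\<And>s. 0 \<le> s \<Longrightarrow> s \<le> ptime \<eta> \<Longrightarrow> norm (pval \<eta> s) \<le> B"
    using bounded_pval[of \<eta>] unfolding bounded_iff by fastforce
  have "norm (pval \<gamma> (min s (ptime \<gamma>)) - pval \<eta> (min s (ptime \<eta>))) \<le> A + B" if "0 \<le> s" for s
    by (rule norm_triangle_le_diff, rule add_mono; (rule A | rule B))
      (use that ptime_nonneg[of \<gamma>] ptime_nonneg[of \<eta>] in auto)
  then show ?thesis by (intro bdd_aboveI2[of _ _ "A + B"]) auto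
qed

lemma dist0_upper:
  assumes "0 \<le> s"
  shows "norm (pval \<gamma> (min s (ptime \<gamma>)) - pval \<eta> (min s (ptime \<eta>))) \<le> dist0 \<gamma> \<eta>"
proof -
  define r where "r = max (ptime \<gamma>) (ptime \<eta>)"
  define s' where "s' = min s r"
  have *: "min s (ptime \<gamma>) = min s' (ptime \<gamma>)" "min s (ptime \<eta>) = min s' (ptime \<eta>)"
    by (auto simp: s'_def r_def)
  have "s' \<in> {0..r}" using assms ptime_nonneg[of \<gamma>] by (auto simp: s'_def r_def)
  then show ?thesis
    unfolding dist0_eq[OF r_def[symmetric]] *
    by (rule cSUP_upper[OF _ bdd_above_dist0])
qed

lemma dist0_least:
  assumes "\<And>s. 0 \<le> s \<Longrightarrow> norm (pval \<gamma> (min s (ptime \<gamma>)) - pval \<eta> (min s (ptime \<eta>))) \<le> C"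
  shows "dist0 \<gamma> \<eta> \<le> C"
  unfolding dist0_eq[OF refl]
  by (rule cSUP_least) (use assms ptime_nonneg[of \<gamma>] in auto)

lemma dist0_nonneg: "0 \<le> dist0 \<gamma> \<eta>"
  by (rule order_trans[OF norm_ge_zero dist0_upper[of 0]]) simp

text \<open>\<open>d\<^sub>\<infinity>\<close>\<close>

instantiation path :: (finite) metric_space
begin

definition dist_path :: "'a path \<Rightarrow> 'a path \<Rightarrow> real" where
  "dist_path \<gamma> \<eta> = \<bar>ptime \<gamma> - ptime \<eta>\<bar> + dist0 \<gamma> \<eta>"

definition uniformity_path :: "('a path \<times> 'a path) filter" where
  "uniformity_path = (INF e\<in>{0<..}. principal {(x, y). dist x y < e})"

definition open_path :: "'a path set \<Rightarrow> bool" where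
  "open_path U \<longleftrightarrow> (\<forall>x\<in>U. \<forall>\<^sub>F (x', y) in uniformity. x' = x \<longrightarrow> y \<in> U)"

instance
proof
  fix x y z :: "'a path"
  show "dist x y = 0 \<longleftrightarrow> x = y"
  proof
    assume "dist x y = 0"
    then have t: "ptime x = ptime y" and d: "dist0 x y = 0"
      using dist0_nonneg[of x y] by (auto simp: dist_path_def)
    show "x = y"
    proof (rule path_eqI[OF t])
      fix s assume "0 \<le> s" "s \<le> ptime x"
      then show "pval x s = pval y s"
        using dist0_upper[of s x y] d t by (simp add: min_def)
    qed
  next
    assume "x = y"
    moreover have "dist0 y y \<le> 0" by (rule dist0_least) simp
    ultimately show "dist x y = 0" using dist0_nonneg[of y y] by (simp add: dist_path_def)
  qed
  have "dist0 x y \<le> dist0 x z + dist0 y z"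
  proof (rule dist0_least)
    fix s :: real assume s: "0 \<le> s"
    have "norm (pval x (min s (ptime x)) - pval y (min s (ptime y)))
        \<le> norm (pval x (min s (ptime x)) - pval z (min s (ptime z)))
          + norm (pval y (min s (ptime y)) - pval z (min s (ptime z)))"
      by (metis dist_norm dist_triangle2)
    also have "\<dots> \<le> dist0 x z + dist0 y z"
      by (intro add_mono dist0_upper s)
    finally show "norm (pval x (min s (ptime x)) - pval y (min s (ptime y))) \<le> \<dots>" .
  qed
  then show "dist x y \<le> dist x z + dist y z"
    by (simp add: dist_path_def)
qed (simp_all add: uniformity_path_def open_path_def)

end

text \<open>
  \<open>Lam_hat T t\<close> and \<open>Lam T t\<close> are the unions over \<open>s \<in> [t,T]\<close> of the cadlag resp. continuous
  paths with final time \<open>s\<close>. In particular \<open>Lam T 0\<close> is the whole space of continuous paths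
  and \<open>Lam T T\<close> consists of the continuous paths on \<open>[0,T]\<close>.
\<close>

definition Lam_hat :: "real \<Rightarrow> real \<Rightarrow> 'd::finite path set" where
  "Lam_hat T t = {\<gamma>. t \<le> ptime \<gamma> \<and> ptime \<gamma> \<le> T}"

definition Lam :: "real \<Rightarrow> real \<Rightarrow> 'd::finite path set" where
  "Lam T t = {\<gamma>. t \<le> ptime \<gamma> \<and> ptime \<gamma> \<le> T \<and> continuous_on {0..ptime \<gamma>} (pval \<gamma>)}"

section \<open>Pathwise derivatives\<close>

definition dx_quot :: "('d::finite path \<Rightarrow> real) \<Rightarrow> 'd \<Rightarrow> 'd path \<Rightarrow> real \<Rightarrow> real" where
  "dx_quot f i \<gamma> h = (f (bump \<gamma> (h *\<^sub>R axis i 1)) - f \<gamma>) / h"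

definition has_dx :: "('d::finite path \<Rightarrow> real) \<Rightarrow> 'd \<Rightarrow> 'd path \<Rightarrow> bool" where
  "has_dx f i \<gamma> \<longleftrightarrow> (\<exists>l. (dx_quot f i \<gamma> \<longlongrightarrow> l) (at 0))"

definition dx :: "('d::finite path \<Rightarrow> real) \<Rightarrow> 'd \<Rightarrow> 'd path \<Rightarrow> real" where
  "dx f i \<gamma> = Lim (at 0) (dx_quot f i \<gamma>)"

definition dt_quot :: "('d::finite path \<Rightarrow> real) \<Rightarrow> 'd path \<Rightarrow> real \<Rightarrow> real" where
  "dt_quot f \<gamma> h = (f (prolong (ptime \<gamma> + h) \<gamma>) - f \<gamma>) / h"

text \<open>At the horizon \<open>T\<close> the time derivative is the left limit of the time derivatives along the
  restrictions of the path.\<close>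

definition has_dt :: "real \<Rightarrow> ('d::finite path \<Rightarrow> real) \<Rightarrow> 'd path \<Rightarrow> bool" where
  "has_dt T f \<gamma> \<longleftrightarrow>
     (if ptime \<gamma> < T then \<exists>l. (dt_quot f \<gamma> \<longlongrightarrow> l) (at_right 0)
      else \<exists>l. ((\<lambda>s. Lim (at_right 0) (dt_quot f (cut s \<gamma>))) \<longlongrightarrow> l) (at_left T))"

definition dt :: "real \<Rightarrow> ('d::finite path \<Rightarrow> real) \<Rightarrow> 'd path \<Rightarrow> real" where
  "dt T f \<gamma> =
     (if ptime \<gamma> < T then Lim (at_right 0) (dt_quot f \<gamma>)
      else Lim (at_left T) (\<lambda>s. Lim (at_right 0) (dt_quot f (cut s \<gamma>))))"

definition poly_growth_on :: "'d::finite path set \<Rightarrow> ('d path \<Rightarrow> real) \<Rightarrow> bool" where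
  "poly_growth_on S f \<longleftrightarrow> (\<exists>C. \<exists>k::nat. \<forall>\<gamma>\<in>S. \<bar>f \<gamma>\<bar> \<le> C * (1 + norm0 \<gamma> ^ k))"

definition C12p_hat :: "real \<Rightarrow> real \<Rightarrow> ('d::finite path \<Rightarrow> real) set" where
  "C12p_hat T t = {f.
     (\<forall>\<gamma>\<in>Lam_hat T t. has_dt T f \<gamma> \<and> (\<forall>i. has_dx f i \<gamma>) \<and> (\<forall>i j. has_dx (dx f j) i \<gamma>)) \<and>
     (\<forall>g \<in> {f, dt T f} \<union> range (dx f) \<union> {dx (dx f j) i |i j. True}.
        continuous_on (Lam_hat T t) g \<and> poly_growth_on (Lam_hat T t) g)}"

definition extends_on :: "real \<Rightarrow> real \<Rightarrow> ('d::finite path \<Rightarrow> real) \<Rightarrow> ('d path \<Rightarrow> real) \<Rightarrow> bool" where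
  "extends_on T t f g \<longleftrightarrow> g \<in> C12p_hat T t \<and> (\<forall>\<gamma>\<in>Lam T t. g \<gamma> = f \<gamma>)"

definition C12p :: "real \<Rightarrow> real \<Rightarrow> ('d::finite path \<Rightarrow> real) set" where
  "C12p T t = {f. \<exists>g. extends_on T t f g}"

text \<open>
  The derivatives on continuous paths are those of an extension to cadlag paths. They do not
  depend on the extension, so an arbitrary one is selected.
\<close>

definition some_ext :: "real \<Rightarrow> real \<Rightarrow> ('d::finite path \<Rightarrow> real) \<Rightarrow> 'd path \<Rightarrow> real" where
  "some_ext T t f = (SOME g. extends_on T t f g)"

definition Dt :: "real \<Rightarrow> real \<Rightarrow> ('d::finite path \<Rightarrow> real) \<Rightarrow> 'd path \<Rightarrow> real" where
  "Dt T t f \<gamma> = dt T (some_ext T t f) \<gamma>"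

definition Dx :: "real \<Rightarrow> real \<Rightarrow> ('d::finite path \<Rightarrow> real) \<Rightarrow> 'd path \<Rightarrow> real^'d" where
  "Dx T t f \<gamma> = (\<chi> i. dx (some_ext T t f) i \<gamma>)"

definition Dxx :: "real \<Rightarrow> real \<Rightarrow> ('d::finite path \<Rightarrow> real) \<Rightarrow> 'd path \<Rightarrow> real^'d^'d" where
  "Dxx T t f \<gamma> = (\<chi> i j. dx (dx (some_ext T t f) j) i \<gamma>)"

section \<open>The equation\<close>

text \<open>
  A \<open>d \<times> n\<close> matrix has type \<open>real^'n^'d\<close>, and its \<^const>\<open>norm\<close> is the Hilbert-Schmidt norm.
\<close>

definition hyp_H :: "real \<Rightarrow> ('d::finite path \<Rightarrow> 'u::polish_space \<Rightarrow> real^'d)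
    \<Rightarrow> ('d path \<Rightarrow> 'u \<Rightarrow> real^'n::finite^'d)
    \<Rightarrow> ('d path \<Rightarrow> real \<Rightarrow> real^'n \<Rightarrow> 'u \<Rightarrow> real) \<Rightarrow> ('d path \<Rightarrow> real) \<Rightarrow> bool" where
  "hyp_H T b \<sigma> q \<phi> \<longleftrightarrow>
     continuous_on (Lam T 0 \<times> UNIV) (\<lambda>(\<gamma>, u). b \<gamma> u) \<and>
     continuous_on (Lam T 0 \<times> UNIV) (\<lambda>(\<gamma>, u). \<sigma> \<gamma> u) \<and>
     continuous_on (Lam T 0 \<times> UNIV) (\<lambda>(\<gamma>, y, z, u). q \<gamma> y z u) \<and>
     continuous_on (Lam T T) \<phi> \<and>
     (\<exists>L>0.
       (\<forall>\<gamma>\<in>Lam T 0. \<forall>u.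
          max ((norm (b \<gamma> u))\<^sup>2) ((norm (\<sigma> \<gamma> u))\<^sup>2) \<le> L\<^sup>2 * (1 + (norm0 \<gamma>)\<^sup>2)) \<and>
       (\<forall>\<gamma>\<in>Lam T 0. \<forall>\<gamma>'\<in>Lam T 0. ptime \<gamma> = ptime \<gamma>' \<longrightarrow> (\<forall>u.
          max (norm (b \<gamma> u - b \<gamma>' u)) (norm (\<sigma> \<gamma> u - \<sigma> \<gamma>' u)) \<le> L * dist0 \<gamma> \<gamma>')) \<and>
       (\<forall>\<gamma>\<in>Lam T 0. \<forall>y z u.
          \<bar>q \<gamma> y z u\<bar> \<le> L * (1 + norm0 \<gamma> + \<bar>y\<bar> + norm z)) \<and>
       (\<forall>\<gamma>\<in>Lam T 0. \<forall>\<gamma>'\<in>Lam T 0. ptime \<gamma> = ptime \<gamma>' \<longrightarrow> (\<forall>y y' z z' u.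
          \<bar>q \<gamma> y z u - q \<gamma>' y' z' u\<bar> \<le> L * (dist0 \<gamma> \<gamma>' + \<bar>y - y'\<bar> + norm (z - z')))) \<and>
       (\<forall>\<eta>\<in>Lam T T. \<forall>\<eta>'\<in>Lam T T. \<bar>\<phi> \<eta> - \<phi> \<eta>'\<bar> \<le> L * dist0 \<eta> \<eta>'))"

text \<open>Under \<open>hyp_H\<close> the supremum is over a bounded set.\<close>

definition Ham :: "('d::finite path \<Rightarrow> 'u::polish_space \<Rightarrow> real^'d)
    \<Rightarrow> ('d path \<Rightarrow> 'u \<Rightarrow> real^'n::finite^'d)
    \<Rightarrow> ('d path \<Rightarrow> real \<Rightarrow> real^'n \<Rightarrow> 'u \<Rightarrow> real)
    \<Rightarrow> 'd path \<Rightarrow> real \<Rightarrow> real^'d \<Rightarrow> real^'d^'d \<Rightarrow> real" where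
  "Ham b \<sigma> q \<gamma> r p A =
     (SUP u. p \<bullet> b \<gamma> u + 1 / 2 * trace (A ** (\<sigma> \<gamma> u ** transpose (\<sigma> \<gamma> u)))
             + q \<gamma> r (transpose (\<sigma> \<gamma> u) *v p) u)"

text \<open>\<open>\<L>\<phi>(\<gamma>)\<close> for a functional \<open>\<phi>\<close> regarded as an element of \<open>C12p T t\<close>.\<close>

definition LL :: "real \<Rightarrow> ('d::finite path \<Rightarrow> 'u::polish_space \<Rightarrow> real^'d)
    \<Rightarrow> ('d path \<Rightarrow> 'u \<Rightarrow> real^'n::finite^'d)
    \<Rightarrow> ('d path \<Rightarrow> real \<Rightarrow> real^'n \<Rightarrow> 'u \<Rightarrow> real)
    \<Rightarrow> real \<Rightarrow> ('d path \<Rightarrow> real) \<Rightarrow> 'd path \<Rightarrow> real" where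
  "LL T b \<sigma> q t f \<gamma> = Dt T t f \<gamma> + Ham b \<sigma> q \<gamma> (f \<gamma>) (Dx T t f \<gamma>) (Dxx T t f \<gamma>)"

context
  fixes T :: real
    and b :: "'d::finite path \<Rightarrow> 'u::polish_space \<Rightarrow> real^'d"
    and \<sigma> :: "'d path \<Rightarrow> 'u \<Rightarrow> real^'n::finite^'d"
    and q :: "'d path \<Rightarrow> real \<Rightarrow> real^'n \<Rightarrow> 'u \<Rightarrow> real"
    and \<phi> :: "'d path \<Rightarrow> real"
begin

definition classical_solution :: "('d path \<Rightarrow> real) \<Rightarrow> bool" where
  "classical_solution v \<longleftrightarrow> v \<in> C12p T 0 \<and>
     (\<forall>\<gamma>\<in>Lam T T. v \<gamma> = \<phi> \<gamma>) \<and>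
     (\<forall>\<gamma>\<in>Lam T 0. ptime \<gamma> < T \<longrightarrow> LL T b \<sigma> q 0 v \<gamma> = 0)"

definition classical_subsolution :: "('d path \<Rightarrow> real) \<Rightarrow> bool" where
  "classical_subsolution v \<longleftrightarrow> v \<in> C12p T 0 \<and>
     (\<forall>\<gamma>\<in>Lam T T. v \<gamma> \<le> \<phi> \<gamma>) \<and>
     (\<forall>\<gamma>\<in>Lam T 0. ptime \<gamma> < T \<longrightarrow> LL T b \<sigma> q 0 v \<gamma> \<ge> 0)"

definition classical_supersolution :: "('d path \<Rightarrow> real) \<Rightarrow> bool" where
  "classical_supersolution v \<longleftrightarrow> v \<in> C12p T 0 \<and>
     (\<forall>\<gamma>\<in>Lam T T. v \<gamma> \<ge> \<phi> \<gamma>) \<and>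
     (\<forall>\<gamma>\<in>Lam T 0. ptime \<gamma> < T \<longrightarrow> LL T b \<sigma> q 0 v \<gamma> \<le> 0)"

end

definition usc_on :: "'a::topological_space set \<Rightarrow> ('a \<Rightarrow> real) \<Rightarrow> bool" where
  "usc_on S f \<longleftrightarrow> (\<forall>x\<in>S. \<forall>c. f x < c \<longrightarrow> (\<forall>\<^sub>F y in at x within S. f y < c))"

definition lsc_on :: "'a::topological_space set \<Rightarrow> ('a \<Rightarrow> real) \<Rightarrow> bool" where
  "lsc_on S f \<longleftrightarrow> (\<forall>x\<in>S. \<forall>c. c < f x \<longrightarrow> (\<forall>\<^sub>F y in at x within S. c < f y))"

text \<open>The supremum and infimum are taken in the extended reals, where they always exist.\<close>

definition test_above :: "real \<Rightarrow> 'd::finite path \<Rightarrow> ('d path \<Rightarrow> real) \<Rightarrow> ('d path \<Rightarrow> real) set" where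
  "test_above T \<gamma> w = {f \<in> C12p T (ptime \<gamma>).
     0 = w \<gamma> - f \<gamma> \<and>
     ereal (w \<gamma> - f \<gamma>) = (SUP \<eta>\<in>Lam T (ptime \<gamma>). ereal (w \<eta> - f \<eta>))}"

definition test_below :: "real \<Rightarrow> 'd::finite path \<Rightarrow> ('d path \<Rightarrow> real) \<Rightarrow> ('d path \<Rightarrow> real) set" where
  "test_below T \<gamma> w = {f \<in> C12p T (ptime \<gamma>).
     0 = w \<gamma> - f \<gamma> \<and>
     ereal (w \<gamma> - f \<gamma>) = (INF \<eta>\<in>Lam T (ptime \<gamma>). ereal (w \<eta> - f \<eta>))}"

context
  fixes T :: real
    and b :: "'d::finite path \<Rightarrow> 'u::polish_space \<Rightarrow> real^'d"
    and \<sigma> :: "'d path \<Rightarrow> 'u \<Rightarrow> real^'n::finite^'d"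
    and q :: "'d path \<Rightarrow> real \<Rightarrow> real^'n \<Rightarrow> 'u \<Rightarrow> real"
    and \<phi> :: "'d path \<Rightarrow> real"
begin

definition viscosity_subsolution :: "('d path \<Rightarrow> real) \<Rightarrow> bool" where
  "viscosity_subsolution w \<longleftrightarrow> usc_on (Lam T 0) w \<and>
     (\<forall>\<gamma>\<in>Lam T T. w \<gamma> \<le> \<phi> \<gamma>) \<and>
     (\<forall>\<gamma>\<in>Lam T 0. ptime \<gamma> < T \<longrightarrow>
        (\<forall>f\<in>test_above T \<gamma> w. LL T b \<sigma> q (ptime \<gamma>) f \<gamma> \<ge> 0))"

definition viscosity_supersolution :: "('d path \<Rightarrow> real) \<Rightarrow> bool" where
  "viscosity_supersolution w \<longleftrightarrow> lsc_on (Lam T 0) w \<and>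
     (\<forall>\<gamma>\<in>Lam T T. w \<gamma> \<ge> \<phi> \<gamma>) \<and>
     (\<forall>\<gamma>\<in>Lam T 0. ptime \<gamma> < T \<longrightarrow>
        (\<forall>f\<in>test_below T \<gamma> w. LL T b \<sigma> q (ptime \<gamma>) f \<gamma> \<le> 0))"

definition viscosity_solution :: "('d path \<Rightarrow> real) \<Rightarrow> bool" where
  "viscosity_solution w \<longleftrightarrow>
     continuous_on (Lam T 0) w \<and> viscosity_subsolution w \<and> viscosity_supersolution w"

end

end

theory Submission
  imports Defs "HOL-Probability.Probability_Mass_Function" "HOL-Complex_Analysis.Great_Picard"
begin

text \<open>
  A functional in \<^const>\<open>C12p\<close> touches itself from above and from below, so it is an admissible test
  functional for itself, and a viscosity solution of this class is a classical one. Everything else is a comparison principle at a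
  point of contact (\<open>LL_mono_of_contact\<close>): if \<open>f \<le> g\<close> on the continuous paths with final time
  at least \<open>ptime \<gamma>\<close> and \<open>f \<gamma> = g \<gamma>\<close>, then \<open>\<L>f(\<gamma>) \<le> \<L>g(\<gamma>)\<close>. Applied to a solution and a test functional it
  gives the other direction. Applied twice to \<open>v\<close> itself, regarded as a functional from time \<open>0\<close> and
  from time \<open>ptime \<gamma>\<close>, it shows that \<open>\<L>v(\<gamma>)\<close> does not depend on the extension of \<open>v\<close> to cadlag paths
  through which it is computed.

  The Hamiltonian is monotone in the quadratic form of the Hessian, so the comparison reduces to a
  maximum principle for a functional \<open>f\<close> on cadlag paths that vanishes at a continuous path \<open>\<gamma>\<close> and
  is \<open>\<le> 0\<close> on continuous paths: at \<open>\<gamma>\<close> the time derivative is \<open>\<le> 0\<close>, the gradient is \<open>0\<close> and the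
  Hessian is negative semidefinite. The difficulty is that \<open>f\<close> is only controlled on continuous paths,
  while its space derivatives are taken along jumps; a continuous path does not see the Hessian at
  all unless it has quadratic variation. The classical tool is the functional Ito formula along a
  diffusion. Here the diffusion is replaced by a finite random walk, so that no stochastic calculus
  is needed.

  Suppose \<open>f\<close> has a positive second derivative at \<open>\<gamma>\<close> in the direction \<open>e\<close>, hence also near \<open>\<gamma>\<close>. From
  \<open>\<gamma>\<close> run \<open>2\<^sup>n\<close> fair steps \<open>\<plusminus>a\<close> parallel to \<open>e\<close>, with \<open>|a|\<^sup>2\<close> of order \<open>2\<^sup>-\<^sup>n\<close>, within a time
  \<open>h\<close>. Averaged over the sign, each step increases \<open>f\<close> by a multiple of \<open>|a|\<^sup>2\<close>, while waiting costs at
  most a multiple of the elapsed time. If \<open>h\<close> is small, the mean of \<open>f\<close> at the end is bounded below by a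
  positive number that does not depend on \<open>n\<close> (\<open>walk_expectation_ge\<close>), so some run attains it
  (\<open>ascending_path_exists\<close>). To let \<open>n\<close> tend to infinity, these runs must be precompact. For this the
  walk is built from dyadic blocks, and a block whose first half has moved too far rests during its
  second half. All runs then obey one modulus of continuity (\<open>walk_modulus\<close>), and Chebyshev's
  inequality shows that resting costs only a fixed fraction of the gain. An Arzela-Ascoli argument
  gives a subsequence converging in \<open>d\<^sub>\<infinity>\<close> to a continuous path
  (\<open>equicontinuous_prolongations_converge\<close>) on which \<open>f\<close> is positive, a contradiction
  (\<open>hessian_form_nonpos_of_max\<close>).

  The gradient condition needs no second walk: \<open>exp (l f) - 1\<close> has its maximum at the same point, and
  its Hessian contains \<open>l\<^sup>2\<close> times the square of the gradient, which dominates for large \<open>l\<close>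
  (\<open>gradient_zero_of_max\<close>).
\<close>

section \<open>One-sided calculus, partial derivatives and compactness\<close>

text \<open>
  The time derivative of a functional along a frozen path is only one-sided, so the mean value theorem
  does not apply. Instead, the last time up to which the bound holds is continued to the right.
\<close>

lemma right_derivative_lower_bound:
  fixes u :: "real \<Rightarrow> real"
  assumes "a \<le> b" and cont: "continuous_on {a..b} u"
    and deriv: "\<And>t. a \<le> t \<Longrightarrow> t < b \<Longrightarrow> ((\<lambda>h. (u (t + h) - u t) / h) \<longlongrightarrow> u' t) (at_right 0)"
    and less: "\<And>t. a \<le> t \<Longrightarrow> t < b \<Longrightarrow> k < u' t"
  shows "u a + k * (b - a) \<le> u b"
proof -
  define A where "A = {t \<in> {a..b}. u a + k * (t - a) \<le> u t}"
  have "closed A"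
    unfolding A_def by (intro continuous_on_closed_Collect_le cont continuous_intros closed_atLeastAtMost)
  moreover have "bounded A"
    by (rule bounded_subset[of "{a..b}"]) (auto simp: A_def)
  moreover have "a \<in> A"
    using assms(1) by (simp add: A_def)
  ultimately obtain s where s: "s \<in> A" "\<And>t. t \<in> A \<Longrightarrow> t \<le> s"
    using compact_attains_sup[of A] by (auto simp: compact_eq_bounded_closed)
  have "s = b"
  proof (rule ccontr)
    assume "s \<noteq> b"
    with s(1) have ab: "a \<le> s" "s < b" by (auto simp: A_def)
    have "\<forall>\<^sub>F h in at_right 0. k < (u (s + h) - u s) / h"
      by (rule order_tendstoD(1)[OF deriv less]) (use ab in auto)
    moreover have "\<forall>\<^sub>F h in at_right 0. h < b - s"
      using ab by (intro eventually_at_rightI[of 0 "b - s"]) auto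
    moreover have "\<forall>\<^sub>F h in at_right (0::real). 0 < h"
      by (rule eventually_at_right_less)
    ultimately have "\<forall>\<^sub>F h in at_right 0. s + h \<in> A \<and> 0 < h"
    proof eventually_elim
      case (elim h)
      then have "k * h < u (s + h) - u s"
        by (simp add: pos_less_divide_eq)
      with elim s(1) ab show ?case
        by (auto simp: A_def algebra_simps)
    qed
    then obtain h where "s + h \<in> A" "0 < h"
      using eventually_happens'[OF trivial_limit_at_right_real] by blast
    with s(2)[of "s + h"] show False by simp
  qed
  with s(1) show ?thesis by (simp add: A_def)
qed

text \<open>
  Pathwise derivatives come one coordinate at a time; this makes directional derivatives available.
\<close>

lemma has_derivative_of_continuous_partials:
  fixes \<phi> :: "real^'d::finite \<Rightarrow> real"
  assumes deriv: "\<And>i x. ((\<lambda>t. \<phi> (x + t *\<^sub>R axis i 1)) has_real_derivative P i x) (at 0)"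
    and cont: "\<And>i. isCont (P i) x"
  shows "(\<phi> has_derivative (\<lambda>h. \<Sum>i\<in>UNIV. h $ i * P i x)) (at x)"
proof -
  define proj :: "'d set \<Rightarrow> real^'d \<Rightarrow> real^'d"
    where "proj I h = (\<chi> i. if i \<in> I then h $ i else 0)" for I h
  have deriv': "((\<lambda>t. \<phi> (y + t *\<^sub>R axis i 1)) has_real_derivative P i (y + t *\<^sub>R axis i 1)) (at t)"
    for i y t
    using DERIV_shift[of "\<lambda>t. \<phi> (y + t *\<^sub>R axis i 1)" "P i (y + t *\<^sub>R axis i 1)" 0 t] deriv[of "y + t *\<^sub>R axis i 1" i]
    by (simp add: algebra_simps)
  \<comment> \<open>The coordinates are moved one after the other, and each move is estimated by the mean value
      theorem; each contributes an error of at most \<open>e * norm h\<close>.\<close>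
  have main: "\<exists>d>0. \<forall>h. norm h < d \<longrightarrow>
      \<bar>\<phi> (x + proj I h) - \<phi> x - (\<Sum>i\<in>I. h $ i * P i x)\<bar> \<le> real (card I) * e * norm h"
    if "e > 0" "finite I" for e I
    using that(2)
  proof (induction I rule: finite_induct)
    case empty
    then show ?case by (intro exI[of _ 1]) (simp add: proj_def zero_vec_def[symmetric])
  next
    case (insert i I)
    then obtain d where d: "d > 0" "\<And>h. norm h < d \<Longrightarrow>
      \<bar>\<phi> (x + proj I h) - \<phi> x - (\<Sum>i\<in>I. h $ i * P i x)\<bar> \<le> real (card I) * e * norm h" by blast
    obtain d' where d': "d' > 0" "\<And>y. dist y x < d' \<Longrightarrow> dist (P i y) (P i x) < e"
      using cont[of i] \<open>e > 0\<close> unfolding continuous_at by (auto simp: Lim_at) (metis dist_self)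
    show ?case
    proof (intro exI[of _ "min d d'"] conjI allI impI)
      fix h :: "real^'d" assume h: "norm h < min d d'"
      define y where "y = x + proj I h"
      have eq: "x + proj (insert i I) h = y + (h $ i) *\<^sub>R axis i 1"
        using insert by (auto simp: y_def proj_def vec_eq_iff axis_def)
      have "norm ((\<phi> (y + (h $ i) *\<^sub>R axis i 1) - (h $ i) * P i x) - (\<phi> (y + 0 *\<^sub>R axis i 1) - 0 * P i x))
          \<le> e * norm (h $ i - 0)"
      proof (rule field_differentiable_bound[where S = "closed_segment 0 (h $ i)"])
        fix t assume t: "t \<in> closed_segment 0 (h $ i)"
        then have "\<bar>t\<bar> \<le> \<bar>h $ i\<bar>"
          by (auto simp: closed_segment_eq_real_ivl split: if_splits)
        then have "norm (y + t *\<^sub>R axis i 1 - x) \<le> norm h"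
          using insert by (intro norm_le_componentwise_cart) (auto simp: y_def proj_def axis_def)
        then show "norm (P i (y + t *\<^sub>R axis i 1) - P i x) \<le> e"
          using d'(2)[of "y + t *\<^sub>R axis i 1"] h by (simp add: dist_norm)
        show "((\<lambda>t. \<phi> (y + t *\<^sub>R axis i 1) - t * P i x) has_real_derivative P i (y + t *\<^sub>R axis i 1) - P i x)
            (at t within closed_segment 0 (h $ i))"
          by (auto intro!: derivative_eq_intros DERIV_subset[OF deriv'])
      qed auto
      also have "\<dots> \<le> e * norm h"
        using component_le_norm_cart[of h i] \<open>e > 0\<close> by simp
      finally have "\<bar>\<phi> (x + proj (insert i I) h) - \<phi> y - h $ i * P i x\<bar> \<le> e * norm h"
        by (simp add: eq algebra_simps)
      moreover have "\<bar>\<phi> y - \<phi> x - (\<Sum>i\<in>I. h $ i * P i x)\<bar> \<le> real (card I) * e * norm h"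
        unfolding y_def using d(2) h by simp
      ultimately show "\<bar>\<phi> (x + proj (insert i I) h) - \<phi> x - (\<Sum>i\<in>insert i I. h $ i * P i x)\<bar>
          \<le> real (card (insert i I)) * e * norm h"
        using insert by (simp add: algebra_simps)
    qed (use d d' in auto)
  qed
  show ?thesis
    unfolding has_derivative_at_alt
  proof (intro conjI allI impI)
    show "bounded_linear (\<lambda>h. \<Sum>i\<in>UNIV. h $ i * P i x)"
      by (intro bounded_linear_sum bounded_linear_mult_left[THEN bounded_linear_compose] bounded_linear_vec_nth)
    fix e :: real assume "e > 0"
    have U: "x + proj UNIV h = x + h" for h by (simp add: proj_def vec_eq_iff)
    obtain d where d: "d > 0" "\<And>h. norm h < d \<Longrightarrow>
      \<bar>\<phi> (x + h) - \<phi> x - (\<Sum>i\<in>UNIV. h $ i * P i x)\<bar> \<le> real CARD('d) * (e / CARD('d)) * norm h"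
      using main[of "e / CARD('d)" UNIV] \<open>e > 0\<close> unfolding U by auto
    show "\<exists>d>0. \<forall>y. norm (y - x) < d \<longrightarrow>
        norm (\<phi> y - \<phi> x - (\<Sum>i\<in>UNIV. (y - x) $ i * P i x)) \<le> e * norm (y - x)"
    proof (intro exI[of _ d] conjI allI impI)
      fix y assume "norm (y - x) < d"
      from d(2)[OF this] show "norm (\<phi> y - \<phi> x - (\<Sum>i\<in>UNIV. (y - x) $ i * P i x)) \<le> e * norm (y - x)"
        by simp
    qed (rule d(1))
  qed
qed

text \<open>
  The function \<open>\<lambda>x. \<psi> x - k / 2 * x\<^sup>2\<close> is convex, and \<open>0\<close> is the midpoint of \<open>r\<close> and \<open>- r\<close>.
\<close>

lemma symmetric_second_difference_ge:
  fixes \<psi> :: "real \<Rightarrow> real"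
  assumes "0 \<le> r"
    and 1: "\<And>x. \<bar>x\<bar> \<le> r \<Longrightarrow> (\<psi> has_real_derivative \<psi>' x) (at x)"
    and 2: "\<And>x. \<bar>x\<bar> \<le> r \<Longrightarrow> (\<psi>' has_real_derivative \<psi>'' x) (at x)"
    and ge: "\<And>x. \<bar>x\<bar> \<le> r \<Longrightarrow> k \<le> \<psi>'' x"
  shows "2 * \<psi> 0 + k * r\<^sup>2 \<le> \<psi> r + \<psi> (- r)"
proof -
  have "convex_on {-r..r} (\<lambda>x. \<psi> x - k / 2 * x\<^sup>2)"
  proof (rule f''_ge0_imp_convex[where f' = "\<lambda>x. \<psi>' x - k * x" and f'' = "\<lambda>x. \<psi>'' x - k"])
    fix x assume x: "x \<in> {-r..r}"
    then have "\<bar>x\<bar> \<le> r" by auto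
    note 1[OF this, derivative_intros] 2[OF this, derivative_intros]
    show "((\<lambda>x. \<psi> x - k / 2 * x\<^sup>2) has_real_derivative \<psi>' x - k * x) (at x)"
      "((\<lambda>x. \<psi>' x - k * x) has_real_derivative \<psi>'' x - k) (at x)"
      by (auto intro!: derivative_eq_intros)
    show "0 \<le> \<psi>'' x - k" using ge \<open>\<bar>x\<bar> \<le> r\<close> by simp
  qed auto
  from convex_onD[OF this, of "1/2" r "-r"] assms(1) show ?thesis
    by (simp add: field_simps)
qed

text \<open>
  The functions \<open>F n\<close> may be discontinuous: their oscillation at a fixed scale need only be small for
  large \<open>n\<close>. This is the situation of step functions with vanishing step size.
\<close>

lemma asymptotic_Arzela_Ascoli:
  fixes F :: "nat \<Rightarrow> 'a::euclidean_space \<Rightarrow> 'b::{real_normed_vector, heine_borel}"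
  assumes "compact S" and bound: "\<And>n x. x \<in> S \<Longrightarrow> norm (F n x) \<le> M"
    and equi: "\<And>e. e > 0 \<Longrightarrow> \<exists>d>0. \<exists>N. \<forall>n\<ge>N. \<forall>x\<in>S. \<forall>y\<in>S. dist x y < d \<longrightarrow> dist (F n x) (F n y) < e"
  obtains g k where "strict_mono (k :: nat \<Rightarrow> nat)" "continuous_on S g"
    "uniform_limit S (\<lambda>n. F (k n)) g sequentially"
proof -
  obtain D where D: "countable D" "D \<subseteq> S" "S \<subseteq> closure D"
    by (rule separable)
  obtain k where k: "strict_mono (k :: nat \<Rightarrow> nat)" and conv: "\<And>x. x \<in> D \<Longrightarrow> \<exists>l. (\<lambda>n. F (k n) x) \<longlonglongrightarrow> l"
    by (rule function_convergent_subsequence[of D F M]) (use D bound in auto)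
  have kge: "n \<le> k n" for n by (rule strict_mono_imp_increasing[OF k])
  have "uniformly_Cauchy_on S (\<lambda>n. F (k n))"
  proof (rule uniformly_Cauchy_onI)
    fix e :: real assume "e > 0"
    then have "e / 3 > 0" by simp
    from equi[OF this] obtain d N where d: "d > 0" and N: "\<And>n x y. n \<ge> N \<Longrightarrow> x \<in> S \<Longrightarrow> y \<in> S \<Longrightarrow> dist x y < d
        \<Longrightarrow> dist (F n x) (F n y) < e / 3"
      by blast
    have "S \<subseteq> (\<Union>z\<in>D. ball z d)"
    proof
      fix x assume "x \<in> S"
      then obtain z where "z \<in> D" "dist z x < d"
        using D(3) d by (auto simp: closure_approachable subset_iff)
      then show "x \<in> (\<Union>z\<in>D. ball z d)" by auto
    qed
    then obtain D' where D': "D' \<subseteq> D" "finite D'" "S \<subseteq> (\<Union>z\<in>D'. ball z d)"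
      using compactE_image[OF \<open>compact S\<close>, of D "\<lambda>z. ball z d"] by auto
    have "\<forall>z\<in>D'. \<exists>M. \<forall>m\<ge>M. \<forall>n\<ge>M. dist (F (k m) z) (F (k n) z) < e / 3"
    proof
      fix z assume "z \<in> D'"
      then have "Cauchy (\<lambda>n. F (k n) z)"
        using conv D' LIMSEQ_imp_Cauchy by blast
      then show "\<exists>M. \<forall>m\<ge>M. \<forall>n\<ge>M. dist (F (k m) z) (F (k n) z) < e / 3"
        using \<open>e > 0\<close> unfolding Cauchy_def by (metis divide_pos_pos zero_less_numeral)
    qed
    then obtain M where M: "\<And>z m n. z \<in> D' \<Longrightarrow> m \<ge> M z \<Longrightarrow> n \<ge> M z \<Longrightarrow> dist (F (k m) z) (F (k n) z) < e / 3"
      by metis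
    define M' where "M' = Max (insert N (M ` D'))"
    have M': "N \<le> M'" "\<And>z. z \<in> D' \<Longrightarrow> M z \<le> M'"
      using D'(2) by (auto simp: M'_def)
    show "\<exists>M. \<forall>x\<in>S. \<forall>m\<ge>M. \<forall>n\<ge>M. dist (F (k m) x) (F (k n) x) < e"
    proof (intro exI[of _ M'] ballI allI impI)
      fix x m n assume x: "x \<in> S" "M' \<le> m" "M' \<le> n"
      then obtain z where z: "z \<in> D'" "dist z x < d" using D'(3) by auto
      then have "z \<in> S" using D' D by auto
      have "dist (F (k m) z) (F (k m) x) < e / 3" "dist (F (k n) z) (F (k n) x) < e / 3"
        using x z \<open>z \<in> S\<close> M'(1) kge[of m] kge[of n] by (intro N; simp)+
      moreover have "dist (F (k m) z) (F (k n) z) < e / 3"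
        using x z M'(2)[of z] by (intro M) auto
      ultimately show "dist (F (k m) x) (F (k n) x) < e"
        using dist_triangle[of "F (k m) x" "F (k n) x" "F (k m) z"]
          dist_triangle[of "F (k m) z" "F (k n) x" "F (k n) z"] by (simp add: dist_commute)
    qed
  qed
  then obtain g where g: "uniform_limit S (\<lambda>n. F (k n)) g sequentially"
    using Cauchy_uniformly_convergent[of S "\<lambda>n. F (k n)"] by (auto simp: uniformly_convergent_on_def)
  have "continuous_on S g"
    unfolding continuous_on_iff
  proof (intro ballI allI impI)
    fix x e assume x: "x \<in> S" and "(e::real) > 0"
    then have "e / 3 > 0" by simp
    from equi[OF this] obtain d N where d: "d > 0" and N: "\<And>n x y. n \<ge> N \<Longrightarrow> x \<in> S \<Longrightarrow> y \<in> S \<Longrightarrow> dist x y < d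
        \<Longrightarrow> dist (F n x) (F n y) < e / 3"
      by blast
    show "\<exists>d>0. \<forall>y\<in>S. dist y x < d \<longrightarrow> dist (g y) (g x) < e"
    proof (intro exI[of _ d] conjI ballI impI)
      fix y assume y: "y \<in> S" "dist y x < d"
      have "(\<lambda>n. dist (F (k n) y) (F (k n) x)) \<longlonglongrightarrow> dist (g y) (g x)"
        using x y g by (intro tendsto_dist tendsto_uniform_limitI)
      moreover have "\<forall>n\<ge>N. dist (F (k n) y) (F (k n) x) \<le> e / 3"
        using x y N kge by (meson less_imp_le order_trans)
      ultimately have "dist (g y) (g x) \<le> e / 3"
        by (intro LIMSEQ_le_const2) auto
      then show "dist (g y) (g x) < e" using \<open>e > 0\<close> by simp
    qed (rule d)
  qed
  with k g that show ?thesis by blast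
qed

section \<open>Prolongations and jumps of paths\<close>

abbreviation pend :: "'d::finite path \<Rightarrow> real^'d" where
  "pend \<gamma> \<equiv> pval \<gamma> (ptime \<gamma>)"

lemma continuous_on_imp_cadlag_on:
  fixes f :: "real \<Rightarrow> 'a::topological_space"
  assumes "continuous_on {0..t} f"
  shows "cadlag_on t f"
  unfolding cadlag_on_def
proof (intro conjI allI impI)
  fix s assume s: "0 \<le> s \<and> s < t"
  then have "(f \<longlongrightarrow> f s) (at s within {0..t})"
    using assms by (auto simp: continuous_on)
  then have "(f \<longlongrightarrow> f s) (at s within {s..t})"
    by (rule tendsto_within_subset) (use s in auto)
  then show "(f \<longlongrightarrow> f s) (at_right s)"
    using s by (simp add: at_within_Icc_at_right)
next
  fix s assume s: "0 < s \<and> s \<le> t"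
  then have "(f \<longlongrightarrow> f s) (at s within {0..t})"
    using assms by (auto simp: continuous_on)
  then have "(f \<longlongrightarrow> f s) (at s within {0..s})"
    by (rule tendsto_within_subset) (use s in auto)
  then show "\<exists>l. (f \<longlongrightarrow> l) (at_left s)"
    using s by (auto simp: at_within_Icc_at_left)
qed

lemma pend_prolong: "ptime \<gamma> \<le> r \<Longrightarrow> pend (prolong r \<gamma>) = pend \<gamma>"
  using ptime_nonneg[of \<gamma>] by (simp add: ptime_prolong pval_prolong)

lemma pend_bump: "pend (bump \<gamma> x) = pend \<gamma> + x"
  by (simp add: ptime_bump pval_bump ptime_nonneg)

lemma prolong_self: "prolong (ptime \<gamma>) \<gamma> = \<gamma>"
  by (rule path_eqI) (auto simp: ptime_prolong pval_prolong)

lemma prolong_prolong: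
  assumes "ptime \<gamma> \<le> r" "r \<le> r'"
  shows "prolong r' (prolong r \<gamma>) = prolong r' \<gamma>"
  using assms ptime_nonneg[of \<gamma>]
  by (intro path_eqI) (auto simp: ptime_prolong pval_prolong min_def)

lemma bump_zero: "bump \<gamma> 0 = \<gamma>"
  by (rule path_eqI) (auto simp: ptime_bump pval_bump)

lemma bump_bump: "bump (bump \<gamma> x) y = bump \<gamma> (x + y)"
  by (rule path_eqI) (auto simp: ptime_bump pval_bump ptime_nonneg)

lemma dist_prolong_prolong:
  assumes "ptime \<gamma> \<le> r" "ptime \<gamma> \<le> r'"
  shows "dist (prolong r \<gamma>) (prolong r' \<gamma>) \<le> \<bar>r - r'\<bar>"
proof -
  have "dist0 (prolong r \<gamma>) (prolong r' \<gamma>) \<le> 0"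
    using assms ptime_nonneg[of \<gamma>]
    by (intro dist0_least) (auto simp: ptime_prolong pval_prolong min_def)
  with assms show ?thesis by (simp add: dist_path_def ptime_prolong)
qed

lemma dist_bump_bump: "dist (bump \<gamma> x) (bump \<gamma> y) \<le> norm (x - y)"
proof -
  have "dist0 (bump \<gamma> x) (bump \<gamma> y) \<le> norm (x - y)"
    using ptime_nonneg[of \<gamma>]
    by (intro dist0_least) (auto simp: ptime_bump pval_bump)
  then show ?thesis by (simp add: dist_path_def ptime_bump)
qed

lemma continuous_on_prolong: "continuous_on {ptime \<gamma>..} (\<lambda>r. prolong r \<gamma>)"
  unfolding continuous_on_iff dist_real_def
  by (auto intro!: exI[of _ "e" for e] le_less_trans[OF dist_prolong_prolong])

lemma continuous_on_bump: "continuous_on UNIV (bump \<gamma>)"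
  unfolding continuous_on_iff
  by (auto intro!: exI[of _ "e" for e] le_less_trans[OF dist_bump_bump] simp flip: dist_norm)

lemma Lam_subset_Lam_hat: "Lam T t \<subseteq> Lam_hat T t"
  by (auto simp: Lam_def Lam_hat_def)

lemma bump_in_Lam_hat: "\<gamma> \<in> Lam_hat T t \<Longrightarrow> bump \<gamma> x \<in> Lam_hat T t"
  by (simp add: Lam_hat_def ptime_bump)

lemma prolong_in_Lam_hat:
  "\<gamma> \<in> Lam_hat T t \<Longrightarrow> ptime \<gamma> \<le> r \<Longrightarrow> r \<le> T \<Longrightarrow> prolong r \<gamma> \<in> Lam_hat T t"
  by (simp add: Lam_hat_def ptime_prolong)

lemma prolong_in_Lam:
  assumes "\<gamma> \<in> Lam T t" "ptime \<gamma> \<le> r" "r \<le> T"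
  shows "prolong r \<gamma> \<in> Lam T t"
proof -
  have "continuous_on {0..ptime \<gamma>} (pval \<gamma>)" using assms by (simp add: Lam_def)
  then have "continuous_on {0..r} (\<lambda>s. pval \<gamma> (min s (ptime \<gamma>)))"
    by (rule continuous_on_compose2)
      (use ptime_nonneg[of \<gamma>] in \<open>auto intro!: continuous_on_min continuous_on_id continuous_on_const\<close>)
  moreover have "pval \<gamma> (min s (ptime \<gamma>)) = pval (prolong r \<gamma>) s" if "s \<in> {0..r}" for s
    using that assms by (simp add: pval_prolong)
  ultimately have "continuous_on {0..r} (pval (prolong r \<gamma>))"
    by (rule continuous_on_eq)
  with assms show ?thesis by (auto simp: Lam_def ptime_prolong)
qed

section \<open>Functionals with given pathwise derivatives\<close>

text \<open>
  The derivatives are carried as explicit functionals, so that differences and compositions can be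
  formed without choosing limits again. As with the indices of \<^const>\<open>Dxx\<close>, \<open>fxx i j\<close> is the
  derivative of \<open>fx j\<close> in the direction \<open>i\<close>.
\<close>

definition path_C12 :: "real \<Rightarrow> real \<Rightarrow> ('d::finite path \<Rightarrow> real) \<Rightarrow> ('d path \<Rightarrow> real)
    \<Rightarrow> ('d \<Rightarrow> 'd path \<Rightarrow> real) \<Rightarrow> ('d \<Rightarrow> 'd \<Rightarrow> 'd path \<Rightarrow> real) \<Rightarrow> bool" where
  "path_C12 T t f ft fx fxx \<longleftrightarrow>
     (\<forall>\<eta>\<in>Lam_hat T t. ptime \<eta> < T \<longrightarrow> (dt_quot f \<eta> \<longlongrightarrow> ft \<eta>) (at_right 0)) \<and>
     (\<forall>\<eta>\<in>Lam_hat T t. \<forall>i. (dx_quot f i \<eta> \<longlongrightarrow> fx i \<eta>) (at 0)) \<and>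
     (\<forall>\<eta>\<in>Lam_hat T t. \<forall>i j. (dx_quot (fx j) i \<eta> \<longlongrightarrow> fxx i j \<eta>) (at 0)) \<and>
     continuous_on (Lam_hat T t) f \<and> continuous_on (Lam_hat T t) ft \<and>
     (\<forall>i. continuous_on (Lam_hat T t) (fx i)) \<and> (\<forall>i j. continuous_on (Lam_hat T t) (fxx i j))"

lemma path_C12_continuous:
  assumes "path_C12 T t f ft fx fxx"
  shows "continuous_on (Lam_hat T t) f" "continuous_on (Lam_hat T t) ft"
    "continuous_on (Lam_hat T t) (fx i)" "continuous_on (Lam_hat T t) (fxx i j)"
  using assms by (auto simp: path_C12_def)

lemma path_C12_dt:
  assumes "path_C12 T t f ft fx fxx" "\<eta> \<in> Lam_hat T t" "ptime \<eta> < T"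
  shows "(dt_quot f \<eta> \<longlongrightarrow> ft \<eta>) (at_right 0)"
  using assms by (auto simp: path_C12_def)

lemma dx_quot_tendsto_iff_DERIV:
  "(dx_quot f i \<eta> \<longlongrightarrow> l) (at 0) \<longleftrightarrow>
    ((\<lambda>h. f (bump \<eta> (h *\<^sub>R axis i 1))) has_real_derivative l) (at 0)"
  by (simp add: DERIV_def dx_quot_def[abs_def] bump_zero)

lemma path_C12_DERIV:
  assumes "path_C12 T t f ft fx fxx" "\<eta> \<in> Lam_hat T t"
  shows "((\<lambda>h. f (bump \<eta> (h *\<^sub>R axis i 1))) has_real_derivative fx i \<eta>) (at 0)"
    "((\<lambda>h. fx j (bump \<eta> (h *\<^sub>R axis i 1))) has_real_derivative fxx i j \<eta>) (at 0)"
  using assms by (auto simp: path_C12_def dx_quot_tendsto_iff_DERIV)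

lemma C12p_hat_path_C12:
  assumes "f \<in> C12p_hat T t"
  shows "path_C12 T t f (dt T f) (dx f) (\<lambda>i j. dx (dx f j) i)"
proof -
  have "(dt_quot f \<eta> \<longlongrightarrow> dt T f \<eta>) (at_right 0)" if \<eta>: "\<eta> \<in> Lam_hat T t" "ptime \<eta> < T" for \<eta>
  proof -
    have has_dt: "has_dt T f \<eta>"
      using assms \<eta> by (simp add: C12p_hat_def)
    obtain l where "(dt_quot f \<eta> \<longlongrightarrow> l) (at_right 0)"
      using has_dt \<eta>(2) by (auto simp: has_dt_def)
    then show ?thesis
      using \<eta> by (simp add: dt_def tendsto_Lim)
  qed
  moreover have "(dx_quot f i \<eta> \<longlongrightarrow> dx f i \<eta>) (at 0)" if "has_dx f i \<eta>" for f :: "'a path \<Rightarrow> real" and i \<eta>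
    using that by (auto simp: has_dx_def dx_def tendsto_Lim)
  ultimately show ?thesis
    using assms unfolding C12p_hat_def path_C12_def by blast
qed

lemma C12p_hat_antimono: "t \<le> t' \<Longrightarrow> C12p_hat T t \<subseteq> C12p_hat T t'"
proof -
  assume "t \<le> t'"
  then have "Lam_hat T t' \<subseteq> Lam_hat T t" by (auto simp: Lam_hat_def)
  then have "continuous_on (Lam_hat T t') g \<and> poly_growth_on (Lam_hat T t') g"
    if "continuous_on (Lam_hat T t) g \<and> poly_growth_on (Lam_hat T t) g" for g :: "'a path \<Rightarrow> real"
    using that unfolding poly_growth_on_def by (meson continuous_on_subset subsetD)
  then show ?thesis
    using \<open>Lam_hat T t' \<subseteq> Lam_hat T t\<close> unfolding C12p_hat_def by blast
qed

lemma path_C12_subset: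
  assumes "path_C12 T t f ft fx fxx" "t \<le> t'"
  shows "path_C12 T t' f ft fx fxx"
proof -
  have "Lam_hat T t' \<subseteq> Lam_hat T t" using assms(2) by (auto simp: Lam_hat_def)
  then show ?thesis
    using assms(1) unfolding path_C12_def by (meson continuous_on_subset subsetD)
qed

lemma path_C12_diff:
  assumes f: "path_C12 T t f ft fx fxx" and g: "path_C12 T t g gt gx gxx"
  shows "path_C12 T t (\<lambda>\<eta>. f \<eta> - g \<eta>) (\<lambda>\<eta>. ft \<eta> - gt \<eta>) (\<lambda>i \<eta>. fx i \<eta> - gx i \<eta>)
    (\<lambda>i j \<eta>. fxx i j \<eta> - gxx i j \<eta>)"
proof -
  have "dt_quot (\<lambda>\<eta>. f \<eta> - g \<eta>) \<eta> = (\<lambda>h. dt_quot f \<eta> h - dt_quot g \<eta> h)" for \<eta>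
    by (auto simp: dt_quot_def diff_divide_distrib)
  moreover have "dx_quot (\<lambda>\<eta>. f \<eta> - g \<eta>) i \<eta> = (\<lambda>h. dx_quot f i \<eta> h - dx_quot g i \<eta> h)"
    for f g :: "'a path \<Rightarrow> real" and i \<eta>
    by (auto simp: dx_quot_def diff_divide_distrib)
  ultimately show ?thesis
    using f g unfolding path_C12_def by (auto intro!: tendsto_diff continuous_on_diff)
qed

text \<open>
  A strictly increasing convex transformation keeps the set where a functional is \<open>\<le> 0\<close> and adds
  a square of the gradient to the Hessian.
\<close>

lemma path_C12_exp:
  fixes f :: "'d::finite path \<Rightarrow> real"
  assumes f: "path_C12 T t f ft fx fxx"
  shows "path_C12 T t (\<lambda>\<eta>. exp (l * f \<eta>) - 1) (\<lambda>\<eta>. l * exp (l * f \<eta>) * ft \<eta>)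
    (\<lambda>i \<eta>. l * exp (l * f \<eta>) * fx i \<eta>)
    (\<lambda>i j \<eta>. l * exp (l * f \<eta>) * (fxx i j \<eta> + l * fx i \<eta> * fx j \<eta>))"
  unfolding path_C12_def
proof (intro conjI ballI allI impI)
  fix \<eta> :: "'d path" assume \<eta>: "\<eta> \<in> Lam_hat T t"
  note path_C12_DERIV[OF f \<eta>, derivative_intros]
  show "(dx_quot (\<lambda>\<eta>. exp (l * f \<eta>) - 1) i \<eta> \<longlongrightarrow> l * exp (l * f \<eta>) * fx i \<eta>) (at 0)" for i
    unfolding dx_quot_tendsto_iff_DERIV
    by (auto intro!: derivative_eq_intros simp: bump_zero)
  show "(dx_quot (\<lambda>\<eta>. l * exp (l * f \<eta>) * fx j \<eta>) i \<eta> \<longlongrightarrow>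
      l * exp (l * f \<eta>) * (fxx i j \<eta> + l * fx i \<eta> * fx j \<eta>)) (at 0)" for i j
    unfolding dx_quot_tendsto_iff_DERIV
    by (auto intro!: derivative_eq_intros simp: bump_zero algebra_simps)
  assume T: "ptime \<eta> < T"
  have "((\<lambda>h. f (prolong (ptime \<eta> + h) \<eta>)) has_real_derivative ft \<eta>) (at 0 within {0<..})"
    using path_C12_dt[OF f \<eta> T]
    by (simp add: has_field_derivative_iff dt_quot_def[abs_def] prolong_self)
  note this[derivative_intros]
  have "((\<lambda>h. exp (l * f (prolong (ptime \<eta> + h) \<eta>)) - 1) has_real_derivative l * exp (l * f \<eta>) * ft \<eta>)
      (at 0 within {0<..})"
    by (auto intro!: derivative_eq_intros simp: prolong_self)
  then show "(dt_quot (\<lambda>\<eta>. exp (l * f \<eta>) - 1) \<eta> \<longlongrightarrow> l * exp (l * f \<eta>) * ft \<eta>) (at_right 0)"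
    by (simp add: has_field_derivative_iff dt_quot_def[abs_def] prolong_self)
qed (use path_C12_continuous[OF f] in \<open>auto intro!: continuous_intros\<close>)

lemma path_C12_bump_line:
  fixes f :: "'d::finite path \<Rightarrow> real"
  assumes f: "path_C12 T t f ft fx fxx" and \<eta>: "\<eta> \<in> Lam_hat T t"
  shows "((\<lambda>x. f (bump \<eta> (x *\<^sub>R e))) has_real_derivative
      (\<Sum>j\<in>UNIV. e $ j * fx j (bump \<eta> (x *\<^sub>R e)))) (at x)"
    and "((\<lambda>x. \<Sum>j\<in>UNIV. e $ j * fx j (bump \<eta> (x *\<^sub>R e))) has_real_derivative
      (\<Sum>i\<in>UNIV. \<Sum>j\<in>UNIV. e $ i * e $ j * fxx i j (bump \<eta> (x *\<^sub>R e)))) (at x)"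
proof -
  \<comment> \<open>The chain rule for a functional with continuous partials, used for \<open>f\<close> and for each \<open>fx j\<close>.\<close>
  have line: "((\<lambda>x. F (bump \<eta> (x *\<^sub>R e))) has_real_derivative
      (\<Sum>i\<in>UNIV. e $ i * P i (bump \<eta> (x *\<^sub>R e)))) (at x)"
    if P: "\<And>i \<eta>. \<eta> \<in> Lam_hat T t \<Longrightarrow>
        ((\<lambda>h. F (bump \<eta> (h *\<^sub>R axis i 1))) has_real_derivative P i \<eta>) (at 0)"
      "\<And>i. continuous_on (Lam_hat T t) (P i)"
    for F :: "'d path \<Rightarrow> real" and P :: "'d \<Rightarrow> 'd path \<Rightarrow> real" and x
  proof -
    have 1: "((\<lambda>y. F (bump \<eta> y)) has_derivative
        (\<lambda>h. \<Sum>i\<in>UNIV. h $ i * P i (bump \<eta> (x *\<^sub>R e)))) (at (x *\<^sub>R e))"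
    proof (rule has_derivative_of_continuous_partials)
      show "((\<lambda>h. F (bump \<eta> (y + h *\<^sub>R axis i 1))) has_real_derivative P i (bump \<eta> y)) (at 0)" for i y
        using P(1)[OF bump_in_Lam_hat[OF \<eta>], of y i] by (simp add: bump_bump)
      have "continuous_on UNIV (\<lambda>y. P i (bump \<eta> y))" for i
        by (rule continuous_on_compose2[OF P(2) continuous_on_bump]) (use bump_in_Lam_hat[OF \<eta>] in auto)
      then show "isCont (\<lambda>y. P i (bump \<eta> y)) (x *\<^sub>R e)" for i
        by (simp add: continuous_on_eq_continuous_at)
    qed
    have "((\<lambda>x. x *\<^sub>R e) has_derivative (\<lambda>h. h *\<^sub>R e)) (at x)"
      by (auto intro!: derivative_eq_intros)
    from diff_chain_at[OF this 1] show ?thesis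
      by (simp add: has_field_derivative_def o_def sum_distrib_left[symmetric] mult.assoc
          mult_commute_abs)
  qed
  show "((\<lambda>x. f (bump \<eta> (x *\<^sub>R e))) has_real_derivative
      (\<Sum>j\<in>UNIV. e $ j * fx j (bump \<eta> (x *\<^sub>R e)))) (at x)"
    by (rule line) (use path_C12_DERIV[OF f] path_C12_continuous[OF f] in auto)
  have "((\<lambda>x. fx j (bump \<eta> (x *\<^sub>R e))) has_real_derivative
      (\<Sum>i\<in>UNIV. e $ i * fxx i j (bump \<eta> (x *\<^sub>R e)))) (at x)" for j
    by (rule line) (use path_C12_DERIV[OF f] path_C12_continuous[OF f] in auto)
  note this[derivative_intros]
  have "((\<lambda>x. \<Sum>j\<in>UNIV. e $ j * fx j (bump \<eta> (x *\<^sub>R e))) has_real_derivative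
      (\<Sum>j\<in>UNIV. e $ j * (\<Sum>i\<in>UNIV. e $ i * fxx i j (bump \<eta> (x *\<^sub>R e))))) (at x)"
    by (auto intro!: derivative_eq_intros simp: mult_ac)
  also have "(\<Sum>j\<in>UNIV. e $ j * (\<Sum>i\<in>UNIV. e $ i * fxx i j (bump \<eta> (x *\<^sub>R e)))) =
      (\<Sum>i\<in>UNIV. \<Sum>j\<in>UNIV. e $ i * e $ j * fxx i j (bump \<eta> (x *\<^sub>R e)))"
    by (subst sum.swap) (simp add: sum_distrib_left mult_ac)
  finally show "((\<lambda>x. \<Sum>j\<in>UNIV. e $ j * fx j (bump \<eta> (x *\<^sub>R e))) has_real_derivative
      (\<Sum>i\<in>UNIV. \<Sum>j\<in>UNIV. e $ i * e $ j * fxx i j (bump \<eta> (x *\<^sub>R e)))) (at x)" .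
qed

lemma path_C12_prolong_ge:
  assumes f: "path_C12 T t f ft fx fxx" and \<eta>: "\<eta> \<in> Lam_hat T t" and r: "ptime \<eta> \<le> r" "r \<le> T"
    and less: "\<And>r'. ptime \<eta> \<le> r' \<Longrightarrow> r' < r \<Longrightarrow> k < ft (prolong r' \<eta>)"
  shows "f \<eta> + k * (r - ptime \<eta>) \<le> f (prolong r \<eta>)"
proof -
  have in_hat: "prolong r' \<eta> \<in> Lam_hat T t" if "ptime \<eta> \<le> r'" "r' \<le> r" for r'
    using that r \<eta> by (intro prolong_in_Lam_hat) auto
  have "continuous_on {ptime \<eta>..r} (\<lambda>r'. f (prolong r' \<eta>))"
    by (rule continuous_on_compose2[OF path_C12_continuous(1)[OF f]
          continuous_on_subset[OF continuous_on_prolong]])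
      (use in_hat in auto)
  moreover have "((\<lambda>h. (f (prolong (r' + h) \<eta>) - f (prolong r' \<eta>)) / h) \<longlongrightarrow> ft (prolong r' \<eta>)) (at_right 0)"
    if "ptime \<eta> \<le> r'" "r' < r" for r'
  proof -
    have "(dt_quot f (prolong r' \<eta>) \<longlongrightarrow> ft (prolong r' \<eta>)) (at_right 0)"
      by (rule path_C12_dt[OF f in_hat]) (use that r in \<open>auto simp: ptime_prolong\<close>)
    moreover have "\<forall>\<^sub>F h in at_right 0. dt_quot f (prolong r' \<eta>) h =
        (f (prolong (r' + h) \<eta>) - f (prolong r' \<eta>)) / h"
      using eventually_at_right_less[of 0]
      by eventually_elim (use that in \<open>simp add: dt_quot_def ptime_prolong prolong_prolong\<close>)
    ultimately show ?thesis by (rule Lim_transform_eventually)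
  qed
  ultimately show ?thesis
    using right_derivative_lower_bound[of "ptime \<eta>" r "\<lambda>r'. f (prolong r' \<eta>)" "\<lambda>r'. ft (prolong r' \<eta>)" k]
      r less by (simp add: prolong_self)
qed

lemma path_C12_symmetric_bump_ge:
  assumes f: "path_C12 T t f ft fx fxx" and \<eta>: "\<eta> \<in> Lam_hat T t" and "0 \<le> r"
    and ge: "\<And>x. \<bar>x\<bar> \<le> r \<Longrightarrow>
      k \<le> (\<Sum>i\<in>UNIV. \<Sum>j\<in>UNIV. e $ i * e $ j * fxx i j (bump \<eta> (x *\<^sub>R e)))"
  shows "2 * f \<eta> + k * r\<^sup>2 \<le> f (bump \<eta> (r *\<^sub>R e)) + f (bump \<eta> (- (r *\<^sub>R e)))"
  using symmetric_second_difference_ge[OF \<open>0 \<le> r\<close> path_C12_bump_line[OF f \<eta>] ge]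
  by (simp add: bump_zero)

section \<open>A random walk with a sure modulus of continuity\<close>

lemma expectation_bind_finite:
  fixes h :: "'b \<Rightarrow> real"
  assumes "finite (set_pmf p)" "\<And>x. x \<in> set_pmf p \<Longrightarrow> finite (set_pmf (f x))"
  shows "measure_pmf.expectation (p \<bind> f) h = measure_pmf.expectation p (\<lambda>x. measure_pmf.expectation (f x) h)"
  using assms by (subst pmf_expectation_bind[of "set_pmf p"]) (auto simp: integral_measure_pmf[of "set_pmf p"])

lemma expectation_mono_finite:
  fixes h :: "'a \<Rightarrow> real"
  assumes "finite (set_pmf p)" "\<And>x. x \<in> set_pmf p \<Longrightarrow> h x \<le> g x"
  shows "measure_pmf.expectation p h \<le> measure_pmf.expectation p g"
  using assms by (intro integral_mono_AE) (auto simp: integrable_measure_pmf_finite AE_measure_pmf_iff)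

lemma ex_ge_expectation_finite:
  fixes h :: "'a \<Rightarrow> real"
  assumes "finite (set_pmf p)"
  shows "\<exists>x\<in>set_pmf p. measure_pmf.expectation p h \<le> h x"
proof -
  have "Max (h ` set_pmf p) \<in> h ` set_pmf p"
    using assms by (intro Max_in) (auto simp: set_pmf_not_empty)
  then obtain x where x: "x \<in> set_pmf p" "h x = Max (h ` set_pmf p)" by force
  have "measure_pmf.expectation p h \<le> measure_pmf.expectation p (\<lambda>_. h x)"
    using assms x(2) by (intro expectation_mono_finite) auto
  with x(1) show ?thesis by auto
qed

text \<open>
  A run of level \<open>m\<close> lasts \<open>2 ^ m\<close> time units \<open>\<tau>\<close>. It consists of two runs of level \<open>m - 1\<close>, except that
  the path rests in the second half if the first half ended further than \<open>w m - w (m - 1)\<close> from its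
  start. Since the second half moves by at most \<open>w (m - 1)\<close>, a run of level \<open>m\<close> stays within \<open>w m\<close> of its
  start. A step of level \<open>0\<close> waits first and jumps at its end, so that the values at multiples of \<open>\<tau>\<close> are
  the positions of the walk and the past of a path is never changed.
\<close>

primrec walk :: "real \<Rightarrow> (nat \<Rightarrow> real) \<Rightarrow> real^'d::finite \<Rightarrow> nat \<Rightarrow> 'd path \<Rightarrow> 'd path pmf" where
  "walk \<tau> w a 0 Y =
     map_pmf (\<lambda>up. bump (prolong (ptime Y + \<tau>) Y) (if up then a else - a)) (bernoulli_pmf (1 / 2))"
| "walk \<tau> w a (Suc m) Y =
     walk \<tau> w a m Y \<bind> (\<lambda>Y'.
       if norm (pend Y' - pend Y) \<le> w (Suc m) - w m then walk \<tau> w a m Y'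
       else return_pmf (prolong (ptime Y' + 2 ^ m * \<tau>) Y'))"

lemma finite_set_walk: "finite (set_pmf (walk \<tau> w a m Y))"
  by (induction m arbitrary: Y) (auto simp: finite_subset[OF subset_UNIV])

lemma expectation_walk_0:
  "measure_pmf.expectation (walk \<tau> w a 0 Y) h =
     (h (bump (prolong (ptime Y + \<tau>) Y) a) + h (bump (prolong (ptime Y + \<tau>) Y) (- a))) / (2::real)"
  by (simp add: integral_bernoulli_pmf)

lemma expectation_walk_Suc:
  fixes h :: "'d::finite path \<Rightarrow> real"
  shows "measure_pmf.expectation (walk \<tau> w a (Suc m) Y) h =
     measure_pmf.expectation (walk \<tau> w a m Y) (\<lambda>Y'.
       if norm (pend Y' - pend Y) \<le> w (Suc m) - w m then measure_pmf.expectation (walk \<tau> w a m Y') h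
       else h (prolong (ptime Y' + 2 ^ m * \<tau>) Y'))"
  unfolding walk.simps
  by (subst expectation_bind_finite) (auto simp: finite_set_walk intro!: Bochner_Integration.integral_cong)

lemma set_walk_SucE:
  assumes "Z \<in> set_pmf (walk \<tau> w a (Suc m) Y)"
  obtains (move) Y' where "Y' \<in> set_pmf (walk \<tau> w a m Y)" "norm (pend Y' - pend Y) \<le> w (Suc m) - w m"
      "Z \<in> set_pmf (walk \<tau> w a m Y')"
    | (wait) Y' where "Y' \<in> set_pmf (walk \<tau> w a m Y)" "Z = prolong (ptime Y' + 2 ^ m * \<tau>) Y'"
  using assms by (auto split: if_splits)

context
  fixes \<tau> :: real and w :: "nat \<Rightarrow> real" and a :: "real^'d::finite"
  assumes \<tau>: "0 < \<tau>" and a: "norm a \<le> w 0" and w: "\<And>m. w m \<le> w (Suc m)"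
begin

lemma ptime_walk:
  assumes "Z \<in> set_pmf (walk \<tau> w a m Y)"
  shows "ptime Z = ptime Y + 2 ^ m * \<tau>"
  using assms
proof (induction m arbitrary: Y Z)
  case 0
  then show ?case using \<tau> by (auto simp: ptime_bump ptime_prolong)
next
  case (Suc m)
  from Suc.prems show ?case
  proof (cases rule: set_walk_SucE)
    case (move Y')
    then show ?thesis by (simp add: Suc.IH[of _ Y] Suc.IH[of _ Y'])
  next
    case (wait Y')
    then show ?thesis using \<tau> by (simp add: Suc.IH[of _ Y] ptime_prolong)
  qed
qed

lemma pval_walk_past:
  assumes "Z \<in> set_pmf (walk \<tau> w a m Y)" "0 \<le> t" "t \<le> ptime Y"
  shows "pval Z t = pval Y t"
  using assms
proof (induction m arbitrary: Y Z)
  case 0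
  then show ?case using \<tau> by (auto simp: ptime_prolong pval_bump pval_prolong)
next
  case (Suc m)
  have t': "t \<le> ptime Y'" if "Y' \<in> set_pmf (walk \<tau> w a m Y)" for Y'
    using ptime_walk[OF that] \<tau> Suc.prems by (simp add: add_increasing2)
  from Suc.prems(1) show ?case
  proof (cases rule: set_walk_SucE)
    case (move Y')
    then show ?thesis using Suc.IH[of _ Y'] Suc.IH[of Y' Y] Suc.prems t' by simp
  next
    case (wait Y')
    then show ?thesis using Suc.IH[of Y' Y] Suc.prems t'[of Y'] \<tau>
      by (simp add: pval_prolong add_increasing2)
  qed
qed

lemma threshold_mono: "m \<le> m' \<Longrightarrow> w m \<le> w m'"
  using lift_Suc_mono_le[of w] w by blast

lemma threshold_nonneg: "0 \<le> w m"
  using a threshold_mono[of 0 m] norm_ge_zero[of a] by linarith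

text \<open>
  This is the bound that the resting rule enforces: on the second half the triangle inequality gives
  \<open>(w (Suc m) - w m) + w m\<close>.
\<close>

lemma walk_stays_near:
  assumes "Z \<in> set_pmf (walk \<tau> w a m Y)" "ptime Y \<le> t" "t \<le> ptime Z"
  shows "norm (pval Z t - pend Y) \<le> w m"
  using assms
proof (induction m arbitrary: Y Z t)
  case 0
  then show ?case using \<tau> a threshold_nonneg[of 0] ptime_nonneg[of Y]
    by (auto simp: ptime_bump ptime_prolong pval_bump pval_prolong min_def)
next
  case (Suc m)
  from Suc.prems(1) show ?case
  proof (cases rule: set_walk_SucE)
    case (move Y')
    note ptime = ptime_walk[OF move(1)]
    show ?thesis
    proof (cases "t \<le> ptime Y'")
      case True
      then have "pval Z t = pval Y' t"
        using pval_walk_past[OF move(3)] Suc.prems(2) ptime_nonneg[of Y] by simp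
      then show ?thesis using Suc.IH[OF move(1) Suc.prems(2) True] w[of m] by simp
    next
      case False
      then have "norm (pval Z t - pend Y') \<le> w m"
        using Suc.IH[OF move(3)] Suc.prems(3) by simp
      with move(2) show ?thesis
        using norm_triangle_ineq[of "pval Z t - pend Y'" "pend Y' - pend Y"] by simp
    qed
  next
    case (wait Y')
    note ptime = ptime_walk[OF wait(1)]
    have Z: "pval Z t = pval Y' (min t (ptime Y'))"
      using Suc.prems(2,3) \<tau> ptime_nonneg[of Y] unfolding wait(2)
      by (simp add: ptime_prolong pval_prolong)
    have "ptime Y \<le> min t (ptime Y')"
      using ptime \<tau> Suc.prems(2) by simp
    then show ?thesis
      using Suc.IH[OF wait(1), where t = "min t (ptime Y')"] w[of m] unfolding Z by simp
  qed
qed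

text \<open>
  A run of level \<open>m\<close> is cut into dyadic blocks of level \<open>l\<close>, each of which is a run of level \<open>l\<close> or lies
  in a resting period.
\<close>

lemma walk_oscillation_dyadic:
  fixes i :: nat
  assumes "Z \<in> set_pmf (walk \<tau> w a m Y)" "l \<le> m" "i < 2 ^ (m - l)"
    and "ptime Y + i * (2 ^ l * \<tau>) \<le> t" "t \<le> ptime Y + (i + 1) * (2 ^ l * \<tau>)"
  shows "norm (pval Z t - pval Z (ptime Y + i * (2 ^ l * \<tau>))) \<le> w l"
  using assms
proof (induction m arbitrary: Y Z i)
  case 0
  then show ?case
    using walk_stays_near[of Z 0 Y t] pval_walk_past[of Z 0 Y "ptime Y"] ptime_walk[of Z 0 Y] ptime_nonneg[of Y]
    by simp
next
  case (Suc m)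
  show ?case
  proof (cases "l = Suc m")
    case True
    with Suc.prems show ?thesis
      using walk_stays_near[OF Suc.prems(1), of t] pval_walk_past[OF Suc.prems(1), of "ptime Y"]
        ptime_walk[OF Suc.prems(1)] ptime_nonneg[of Y]
      by simp
  next
    case False
    with Suc.prems have "l \<le> m" by simp
    define n where "n = (2::nat) ^ (m - l)"
    have n: "2 ^ (Suc m - l) = 2 * n" "real n * (2 ^ l * \<tau>) = 2 ^ m * \<tau>"
      using \<open>l \<le> m\<close> by (simp_all add: n_def Suc_diff_le power_add[symmetric] flip: mult.assoc)
    define t0 where "t0 = ptime Y + i * (2 ^ l * \<tau>)"
    have t0: "0 \<le> t0" "t0 \<le> t"
      using Suc.prems(4) \<tau> ptime_nonneg[of Y] by (simp_all add: t0_def)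
    have first: "t \<le> ptime Y + 2 ^ m * \<tau>" if "i < n"
    proof -
      have "(real i + 1) * (2 ^ l * \<tau>) \<le> real n * (2 ^ l * \<tau>)"
        using that \<tau> by (intro mult_right_mono) auto
      moreover have "t \<le> ptime Y + (real i + 1) * (2 ^ l * \<tau>)"
        using Suc.prems(5) by (simp add: add.commute)
      ultimately show ?thesis using n(2) by linarith
    qed
    have second: "t0 = ptime Y + 2 ^ m * \<tau> + real (i - n) * (2 ^ l * \<tau>)" if "\<not> i < n"
      unfolding n(2)[symmetric] using that by (simp add: t0_def algebra_simps of_nat_diff)
    from Suc.prems(1) show ?thesis
    proof (cases rule: set_walk_SucE)
      case (move Y')
      note ptime = ptime_walk[OF move(1)]
      show ?thesis
      proof (cases "i < n")
        case True
        then have "norm (pval Y' t - pval Y' t0) \<le> w l"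
          using Suc.IH[OF move(1) \<open>l \<le> m\<close>, of i] Suc.prems(4,5) by (simp add: t0_def n_def)
        with first[OF True] t0 ptime show ?thesis
          using pval_walk_past[OF move(3), of t] pval_walk_past[OF move(3), of t0] by (simp add: t0_def)
      next
        case False
        with Suc.prems(3) have i: "i - n < 2 ^ (m - l)" by (simp add: n) (simp add: n_def)
        have "t \<le> ptime Y' + (real (i - n) + 1) * (2 ^ l * \<tau>)"
          using Suc.prems(5) second[OF False] by (simp add: ptime t0_def algebra_simps)
        then show ?thesis
          using Suc.IH[OF move(3) \<open>l \<le> m\<close> i] second[OF False] t0 by (simp add: ptime t0_def add_ac)
      qed
    next
      case (wait Y')
      note ptime = ptime_walk[OF wait(1)]
      have "(real i + 1) * (2 ^ l * \<tau>) \<le> real (2 * n) * (2 ^ l * \<tau>)"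
        using Suc.prems(3) \<tau> n(1) by (intro mult_right_mono) (auto simp: Suc_le_eq)
      moreover have "t \<le> ptime Y + (real i + 1) * (2 ^ l * \<tau>)"
        using Suc.prems(5) by (simp add: add.commute)
      moreover have "real (2 * n) * (2 ^ l * \<tau>) = 2 * (2 ^ m * \<tau>)"
        using n(2) by simp
      ultimately have "t \<le> ptime Y' + 2 ^ m * \<tau>"
        using ptime by linarith
      then have Z: "pval Z r = pval Y' (min r (ptime Y'))" if "r = t \<or> r = t0" for r
        using that t0 \<tau> unfolding wait(2) by (auto simp: pval_prolong)
      show ?thesis
      proof (cases "i < n")
        case True
        then have "norm (pval Y' t - pval Y' t0) \<le> w l"
          using Suc.IH[OF wait(1) \<open>l \<le> m\<close>, of i] Suc.prems(4,5) by (simp add: t0_def n_def)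
        with first[OF True] t0 ptime show ?thesis by (simp add: Z t0_def[symmetric] min_absorb1)
      next
        case False
        then have "ptime Y' \<le> t0" using second[OF False] \<tau> by (simp add: ptime)
        then show ?thesis using t0 threshold_nonneg[of l] by (simp add: Z t0_def[symmetric] min_absorb2)
      qed
    qed
  qed
qed

text \<open>
  Two times at distance at most one block length lie in the same dyadic block or in adjacent ones, so
  the path between them is controlled by at most three block oscillations.
\<close>

lemma walk_modulus:
  assumes Z: "Z \<in> set_pmf (walk \<tau> w a m Y)" and "l \<le> m"
    and t: "ptime Y \<le> t" "t \<le> t'" "t' \<le> ptime Z" "t' - t \<le> 2 ^ l * \<tau>"
  shows "norm (pval Z t' - pval Z t) \<le> 3 * w l"
proof -
  define n where "n = (2::nat) ^ (m - l)"
  define c where "c = 2 ^ l * \<tau>"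
  have c: "c > 0" using \<tau> by (simp add: c_def)
  have nc: "real n * c = 2 ^ m * \<tau>"
    using \<open>l \<le> m\<close> by (simp add: n_def c_def power_add[symmetric] flip: mult.assoc)
  have osc: "norm (pval Z r - pval Z (ptime Y + i * c)) \<le> w l"
    if "i < n" "ptime Y + i * c \<le> r" "r \<le> ptime Y + (i + 1) * c" for i r
    using walk_oscillation_dyadic[OF Z \<open>l \<le> m\<close>, of i r] that by (simp add: n_def c_def algebra_simps)
  show ?thesis
  proof (cases "t = ptime Y + n * c")
    case True
    then have "t' = t" using t ptime_walk[OF Z] nc by simp
    then show ?thesis using threshold_nonneg[of l] by simp
  next
    case False
    define i where "i = nat \<lfloor>(t - ptime Y) / c\<rfloor>"
    have q: "0 \<le> (t - ptime Y) / c" using t c by simp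
    have i: "real i \<le> (t - ptime Y) / c" "(t - ptime Y) / c < real i + 1"
      using q unfolding i_def by linarith+
    have it: "ptime Y + i * c \<le> t" "t \<le> ptime Y + (i + 1) * c"
      using i c by (simp_all add: field_simps)
    have "t < ptime Y + n * c"
      using False t ptime_walk[OF Z] nc by simp
    then have "real i * c < real n * c" using it by simp
    then have "i < n" using c by simp
    have 1: "norm (pval Z t - pval Z (ptime Y + i * c)) \<le> w l"
      by (rule osc) (use it \<open>i < n\<close> in \<open>auto simp: algebra_simps\<close>)
    show ?thesis
    proof (cases "t' \<le> ptime Y + (i + 1) * c")
      case True
      have "norm (pval Z t' - pval Z (ptime Y + i * c)) \<le> w l"
        by (rule osc) (use it \<open>i < n\<close> t True in \<open>auto simp: algebra_simps\<close>)
      with 1 show ?thesis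
        using norm_triangle_ineq4[of "pval Z t' - pval Z (ptime Y + i * c)" "pval Z t - pval Z (ptime Y + i * c)"]
          threshold_nonneg[of l] by simp
    next
      case F: False
      then have "real (i + 1) * c < real n * c"
        using t ptime_walk[OF Z] nc by simp
      then have "i + 1 < n" using c by simp
      have 2: "norm (pval Z (ptime Y + (i + 1) * c) - pval Z (ptime Y + i * c)) \<le> w l"
        using osc[OF \<open>i < n\<close>, of "ptime Y + (i + 1) * c"] c by (simp add: algebra_simps)
      have 3: "norm (pval Z t' - pval Z (ptime Y + (i + 1) * c)) \<le> w l"
        using osc[OF \<open>i + 1 < n\<close>, of t'] F t it by (simp add: c_def algebra_simps)
      show ?thesis
        using norm_triangle_ineq[of "pval Z t' - pval Z (ptime Y + (i + 1) * c)"
            "pval Z (ptime Y + (i + 1) * c) - pval Z (ptime Y + i * c)"]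
          norm_triangle_ineq4[of "pval Z t' - pval Z (ptime Y + i * c)" "pval Z t - pval Z (ptime Y + i * c)"]
          1 2 3 by simp
    qed
  qed
qed

text \<open>
  The increments are centred, so their variances add; resting can only lower the sum.
\<close>

lemma walk_second_moment:
  "measure_pmf.expectation (walk \<tau> w a m Y) (\<lambda>Z. (norm (pend Z - y))\<^sup>2)
     \<le> (norm (pend Y - y))\<^sup>2 + 2 ^ m * (norm a)\<^sup>2"
proof (induction m arbitrary: Y)
  case 0
  have "(norm (pend Y + a - y))\<^sup>2 + (norm (pend Y - a - y))\<^sup>2 = 2 * (norm (pend Y - y))\<^sup>2 + 2 * (norm a)\<^sup>2"
    unfolding power2_norm_eq_inner by (simp add: inner_simps algebra_simps inner_commute)
  then show ?case
    using \<tau> ptime_nonneg[of Y]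
    by (simp add: expectation_walk_0 pend_bump ptime_prolong pval_prolong)
next
  case (Suc m)
  have "measure_pmf.expectation (walk \<tau> w a (Suc m) Y) (\<lambda>Z. (norm (pend Z - y))\<^sup>2)
     \<le> measure_pmf.expectation (walk \<tau> w a m Y) (\<lambda>Y'. (norm (pend Y' - y))\<^sup>2 + 2 ^ m * (norm a)\<^sup>2)"
    unfolding expectation_walk_Suc
    by (rule expectation_mono_finite) (use Suc.IH \<tau> in \<open>auto simp: finite_set_walk pend_prolong\<close>)
  also have "\<dots> = measure_pmf.expectation (walk \<tau> w a m Y) (\<lambda>Y'. (norm (pend Y' - y))\<^sup>2) + 2 ^ m * (norm a)\<^sup>2"
    by (subst Bochner_Integration.integral_add)
      (simp_all add: integrable_measure_pmf_finite finite_set_walk)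
  also have "\<dots> \<le> (norm (pend Y - y))\<^sup>2 + 2 ^ Suc m * (norm a)\<^sup>2"
    using Suc.IH[of Y] by simp
  finally show ?case .
qed

text \<open>
  Each of the \<open>2 ^ m\<close> steps would add the gain \<open>g\<close> if no block ever rested. The sum that is subtracted
  from \<open>1\<close> bounds the fraction lost by resting: a block of level \<open>Suc i\<close> rests in its second half with
  probability at most \<open>2 ^ i * (norm a)\<^sup>2 / (w (Suc i) - w i)\<^sup>2\<close>, by Chebyshev's inequality and
  \<open>walk_second_moment\<close>, and then loses at most half of its gain. The hypotheses on \<open>f\<close> concern
  the \<open>R\<close>-neighbourhood of \<open>\<gamma>\<close>, which a run that starts with room \<open>w m\<close> never leaves.
\<close>

lemma walk_expectation_ge:
  fixes f :: "'d path \<Rightarrow> real" and \<gamma> :: "'d path"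
  assumes strict: "\<And>m. w m < w (Suc m)" and "0 \<le> g"
    and wait: "\<And>Y r. ptime \<gamma> \<le> ptime Y \<Longrightarrow> ptime Y \<le> r \<Longrightarrow> r \<le> ptime \<gamma> + h \<Longrightarrow> dist0 \<gamma> Y \<le> R
      \<Longrightarrow> f Y - K * (r - ptime Y) \<le> f (prolong r Y)"
    and jump: "\<And>Y. ptime \<gamma> \<le> ptime Y \<Longrightarrow> ptime Y \<le> ptime \<gamma> + h \<Longrightarrow> dist0 \<gamma> Y \<le> R
      \<Longrightarrow> norm (pend Y - pend \<gamma>) + norm a \<le> R \<Longrightarrow> 2 * (f Y + g) \<le> f (bump Y a) + f (bump Y (- a))"
  assumes "ptime \<gamma> \<le> ptime Y" "ptime Y + 2 ^ m * \<tau> \<le> ptime \<gamma> + h" "dist0 \<gamma> Y \<le> R"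
    and "norm (pend Y - pend \<gamma>) + w m \<le> R"
  shows "f Y + 2 ^ m * (1 - (\<Sum>i<m. 2 ^ i * (norm a)\<^sup>2 / (2 * (w (Suc i) - w i)\<^sup>2))) * g - K * (2 ^ m * \<tau>)
     \<le> measure_pmf.expectation (walk \<tau> w a m Y) f"
  using assms(5-)
proof (induction m arbitrary: Y)
  case 0
  define Y' where "Y' = prolong (ptime Y + \<tau>) Y"
  have Y': "ptime Y' = ptime Y + \<tau>" "pend Y' = pend Y"
    using \<tau> ptime_nonneg[of Y] by (auto simp: Y'_def ptime_prolong pval_prolong)
  have "dist0 \<gamma> Y' \<le> R"
  proof (rule dist0_least)
    fix t :: real assume "0 \<le> t"
    then have "pval Y' (min t (ptime Y')) = pval Y (min t (ptime Y))"
      using \<tau> ptime_nonneg[of Y] by (auto simp: Y'_def ptime_prolong pval_prolong min_def)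
    then show "norm (pval \<gamma> (min t (ptime \<gamma>)) - pval Y' (min t (ptime Y'))) \<le> R"
      using dist0_upper[OF \<open>0 \<le> t\<close>, of \<gamma> Y] 0 by simp
  qed
  then have "2 * (f Y' + g) \<le> f (bump Y' a) + f (bump Y' (- a))"
    using 0 Y' \<tau> a by (intro jump) auto
  moreover have "f Y - K * \<tau> \<le> f Y'"
    using wait[of Y "ptime Y + \<tau>"] 0 \<tau> by (simp add: Y'_def)
  ultimately show ?case
    by (simp add: expectation_walk_0 Y'_def[symmetric])
next
  case (Suc m)
  define E :: "('d path \<Rightarrow> real) \<Rightarrow> real" where "E = measure_pmf.expectation (walk \<tau> w a m Y)"
  define V where "V = 2 ^ m * (1 - (\<Sum>i<m. 2 ^ i * (norm a)\<^sup>2 / (2 * (w (Suc i) - w i)\<^sup>2))) * g"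
  define \<theta> where "\<theta> = w (Suc m) - w m"
  have "\<theta> > 0" using strict by (simp add: \<theta>_def)
  have "V \<le> 2 ^ m * g"
  proof -
    have "0 \<le> (\<Sum>i<m. 2 ^ i * (norm a)\<^sup>2 / (2 * (w (Suc i) - w i)\<^sup>2))"
      by (intro sum_nonneg) auto
    then show ?thesis using \<open>0 \<le> g\<close> unfolding V_def
      by (intro mult_right_mono) (auto simp: mult_le_cancel_left1)
  qed
  have pos: "0 < 2 ^ m * \<tau>" using \<tau> by simp
  \<comment> \<open>A run that stops early forgoes its second half; this costs at most the gain \<open>V\<close> of that half.\<close>
  have key: "f Y' - K * (2 ^ m * \<tau>) + V - 2 ^ m * g * ((norm (pend Y' - pend Y))\<^sup>2 / \<theta>\<^sup>2) \<le>
      (if norm (pend Y' - pend Y) \<le> w (Suc m) - w m then measure_pmf.expectation (walk \<tau> w a m Y') f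
       else f (prolong (ptime Y' + 2 ^ m * \<tau>) Y'))"
    if Y': "Y' \<in> set_pmf (walk \<tau> w a m Y)" for Y'
  proof -
    note ptime = ptime_walk[OF Y']
    have near: "dist0 \<gamma> Y' \<le> R"
    proof (rule dist0_least)
      fix t :: real assume t: "0 \<le> t"
      show "norm (pval \<gamma> (min t (ptime \<gamma>)) - pval Y' (min t (ptime Y'))) \<le> R"
      proof (cases "t \<le> ptime Y")
        case True
        then have "pval Y' (min t (ptime Y')) = pval Y (min t (ptime Y))"
          using ptime pos t pval_walk_past[OF Y', of t] by simp
        then show ?thesis using dist0_upper[OF t, of \<gamma> Y] Suc.prems by simp
      next
        case False
        then have "norm (pval Y' (min t (ptime Y')) - pend Y) \<le> w m"
          using ptime pos by (intro walk_stays_near[OF Y']) auto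
        moreover have "min t (ptime \<gamma>) = ptime \<gamma>" using False Suc.prems by simp
        ultimately show ?thesis
          using norm_triangle_ineq[of "pval Y' (min t (ptime Y')) - pend Y" "pend Y - pend \<gamma>"]
            Suc.prems(4) w[of m] by (simp add: norm_minus_commute)
      qed
    qed
    show ?thesis
    proof (cases "norm (pend Y' - pend Y) \<le> w (Suc m) - w m")
      case True
      then have "norm (pend Y' - pend \<gamma>) + w m \<le> R"
        using norm_triangle_ineq[of "pend Y' - pend Y" "pend Y - pend \<gamma>"] Suc.prems(4) by simp
      then have "f Y' + V - K * (2 ^ m * \<tau>) \<le> measure_pmf.expectation (walk \<tau> w a m Y') f"
        unfolding V_def using Suc.prems pos near by (intro Suc.IH) (auto simp: ptime algebra_simps)
      moreover have "0 \<le> 2 ^ m * g * ((norm (pend Y' - pend Y))\<^sup>2 / \<theta>\<^sup>2)"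
        using \<open>0 \<le> g\<close> by simp
      ultimately show ?thesis using True by simp
    next
      case False
      then have "\<theta>\<^sup>2 \<le> (norm (pend Y' - pend Y))\<^sup>2"
        using \<open>\<theta> > 0\<close> by (intro power_mono) (auto simp: \<theta>_def)
      then have "1 \<le> (norm (pend Y' - pend Y))\<^sup>2 / \<theta>\<^sup>2" using \<open>\<theta> > 0\<close> by simp
      then have "2 ^ m * g * 1 \<le> 2 ^ m * g * ((norm (pend Y' - pend Y))\<^sup>2 / \<theta>\<^sup>2)"
        using \<open>0 \<le> g\<close> by (intro mult_left_mono) auto
      moreover have "f Y' - K * ((ptime Y' + 2 ^ m * \<tau>) - ptime Y') \<le> f (prolong (ptime Y' + 2 ^ m * \<tau>) Y')"
        using Suc.prems pos near by (intro wait) (auto simp: ptime algebra_simps)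
      then have "f Y' - K * (2 ^ m * \<tau>) \<le> f (prolong (ptime Y' + 2 ^ m * \<tau>) Y')"
        by simp
      ultimately show ?thesis
        unfolding if_not_P[OF False] using \<open>V \<le> 2 ^ m * g\<close> by linarith
    qed
  qed
  have "f Y + V - K * (2 ^ m * \<tau>) \<le> E f"
    unfolding E_def V_def using Suc.prems pos w[of m] by (intro Suc.IH) auto
  moreover have "E (\<lambda>Y'. (norm (pend Y' - pend Y))\<^sup>2) \<le> 2 ^ m * (norm a)\<^sup>2"
    using walk_second_moment[of m Y "pend Y"] by (simp add: E_def)
  then have "2 ^ m * g / \<theta>\<^sup>2 * E (\<lambda>Y'. (norm (pend Y' - pend Y))\<^sup>2) \<le> 2 ^ m * g / \<theta>\<^sup>2 * (2 ^ m * (norm a)\<^sup>2)"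
    using \<open>0 \<le> g\<close> by (intro mult_left_mono) auto
  ultimately have "f Y + V - K * (2 ^ m * \<tau>) - K * (2 ^ m * \<tau>) + V - 2 ^ m * g / \<theta>\<^sup>2 * (2 ^ m * (norm a)\<^sup>2)
      \<le> E f + (V - K * (2 ^ m * \<tau>)) - 2 ^ m * g / \<theta>\<^sup>2 * E (\<lambda>Y'. (norm (pend Y' - pend Y))\<^sup>2)"
    by linarith
  also have "\<dots> = E (\<lambda>Y'. f Y' + (V - K * (2 ^ m * \<tau>)) - 2 ^ m * g / \<theta>\<^sup>2 * (norm (pend Y' - pend Y))\<^sup>2)"
    unfolding E_def by (simp add: integrable_measure_pmf_finite finite_set_walk)
  also have "\<dots> \<le> measure_pmf.expectation (walk \<tau> w a (Suc m) Y) f"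
    unfolding expectation_walk_Suc E_def
    by (rule expectation_mono_finite[OF finite_set_walk]) (use key in \<open>auto simp: algebra_simps\<close>)
  also have "f Y + V - K * (2 ^ m * \<tau>) - K * (2 ^ m * \<tau>) + V - 2 ^ m * g / \<theta>\<^sup>2 * (2 ^ m * (norm a)\<^sup>2) =
      f Y + 2 ^ Suc m * (1 - (\<Sum>i<Suc m. 2 ^ i * (norm a)\<^sup>2 / (2 * (w (Suc i) - w i)\<^sup>2))) * g - K * (2 ^ Suc m * \<tau>)"
    using \<open>\<theta> > 0\<close> by (simp add: V_def \<theta>_def[symmetric] field_simps)
  finally show ?case .
qed

end

section \<open>Necessary conditions at a maximum over continuous paths\<close>

text \<open>
  The walk of level \<open>n\<close> with \<open>2 ^ n\<close> steps in time \<open>h\<close> and thresholds that shrink by \<open>3 / 4\<close> from each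
  level to the next finer one. The ratio must exceed \<open>sqrt (1 / 2)\<close>, the scaling of the standard
  deviation, for the losses by resting to form a convergent geometric series, and be below \<open>1\<close> for the
  modulus of continuity to vanish.
\<close>

lemma ascending_path_exists:
  fixes f :: "'d::finite path \<Rightarrow> real" and \<gamma> :: "'d path"
  assumes "0 < h" "0 < R" "0 < \<kappa>" "e \<noteq> 0"
    and wait: "\<And>Y r. ptime \<gamma> \<le> ptime Y \<Longrightarrow> ptime Y \<le> r \<Longrightarrow> r \<le> ptime \<gamma> + h \<Longrightarrow> dist0 \<gamma> Y \<le> R
      \<Longrightarrow> f Y - K * (r - ptime Y) \<le> f (prolong r Y)"
    and jump: "\<And>Y r. ptime \<gamma> \<le> ptime Y \<Longrightarrow> ptime Y \<le> ptime \<gamma> + h \<Longrightarrow> dist0 \<gamma> Y \<le> R \<Longrightarrow> 0 \<le> r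
      \<Longrightarrow> norm (pend Y - pend \<gamma>) + norm (r *\<^sub>R e) \<le> R
      \<Longrightarrow> 2 * f Y + \<kappa> * r\<^sup>2 \<le> f (bump Y (r *\<^sub>R e)) + f (bump Y (- (r *\<^sub>R e)))"
  shows "\<exists>Y. ptime Y = ptime \<gamma> + h \<and> (\<forall>t. 0 \<le> t \<longrightarrow> t \<le> ptime \<gamma> \<longrightarrow> pval Y t = pval \<gamma> t) \<and>
      (\<forall>t. ptime \<gamma> \<le> t \<longrightarrow> t \<le> ptime \<gamma> + h \<longrightarrow> norm (pval Y t - pend \<gamma>) \<le> R) \<and>
      (\<forall>k\<le>n. \<forall>t t'. ptime \<gamma> \<le> t \<longrightarrow> t \<le> t' \<longrightarrow> t' \<le> ptime \<gamma> + h \<longrightarrow> t' - t \<le> h / 2 ^ k \<longrightarrow>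
        norm (pval Y t' - pval Y t) \<le> 3 * (R * (3 / 4) ^ k)) \<and>
      f \<gamma> + \<kappa> * R\<^sup>2 / (288 * (norm e)\<^sup>2) - K * h \<le> f Y"
proof -
  \<comment> \<open>\<open>Q\<close> is the quadratic variation of a run that never rests; the factor \<open>1 / 72\<close> makes the total loss
      at most one half, whence a gain of \<open>G\<close>.\<close>
  define Q where "Q = R\<^sup>2 / 72"
  define G where "G = \<kappa> * Q / (4 * (norm e)\<^sup>2)"
  have "0 < Q" using \<open>0 < R\<close> by (simp add: Q_def)
  define \<tau> where "\<tau> = h / 2 ^ n"
  define w where "w m = R * (3 / 4) ^ n * (4 / 3) ^ m" for m :: nat
  define r where "r = sqrt (Q / 2 ^ n) / norm e"
  define a where "a = r *\<^sub>R e"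
  have \<tau>: "\<tau> > 0" "2 ^ n * \<tau> = h" using \<open>0 < h\<close> by (auto simp: \<tau>_def)
  have r: "0 \<le> r" "r\<^sup>2 = Q / 2 ^ n / (norm e)\<^sup>2"
    using \<open>Q > 0\<close> by (simp_all add: r_def power_divide)
  have a: "(norm a)\<^sup>2 = Q / 2 ^ n"
    using \<open>e \<noteq> 0\<close> r by (simp add: a_def power_mult_distrib)
  have w_less: "w m < w (Suc m)" for m
    using \<open>R > 0\<close> by (simp add: w_def)
  have w_eq: "w m = R * (3 / 4) ^ (n - m)" if "m \<le> n" for m
  proof -
    have "(3 / 4 :: real) ^ n = (3 / 4) ^ (n - m) * (3 / 4) ^ m"
      using that by (simp flip: power_add)
    then show ?thesis by (simp add: w_def power_mult_distrib[symmetric])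
  qed
  have aw: "norm a \<le> w 0"
  proof (rule power2_le_imp_le)
    have "Q / 2 ^ n = R\<^sup>2 / 72 * (1 / 2) ^ n" by (simp add: Q_def power_divide)
    also have "\<dots> \<le> R\<^sup>2 * (9 / 16) ^ n"
      by (intro mult_mono power_mono) auto
    also have "\<dots> = (w 0)\<^sup>2" by (simp add: w_def power_mult_distrib power2_eq_square flip: power_mult_distrib)
    finally show "(norm a)\<^sup>2 \<le> (w 0)\<^sup>2" by (simp add: a)
    show "0 \<le> w 0" using \<open>R > 0\<close> by (simp add: w_def)
  qed
  note walk = \<tau>(1) aw less_imp_le[OF w_less]
  have loss: "(\<Sum>i<n. 2 ^ i * (norm a)\<^sup>2 / (2 * (w (Suc i) - w i)\<^sup>2)) \<le> 1 / 2"
  proof -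
    have "2 ^ i * (norm a)\<^sup>2 / (2 * (w (Suc i) - w i)\<^sup>2) = 1 / 18 * (8 / 9) ^ (n - Suc i)"
      if "i < n" for i
    proof -
      define j where "j = n - Suc i"
      have n: "n = Suc (i + j)" using that by (simp add: j_def)
      have "w (Suc i) - w i = R / 4 * (3 / 4) ^ j"
        using that w_eq[of i] w_eq[of "Suc i"] by (simp add: n)
      moreover have "((3 :: real) ^ j)\<^sup>2 = 9 ^ j" "((4 :: real) ^ j)\<^sup>2 = 16 ^ j"
        by (simp_all add: power2_eq_square flip: power_mult_distrib)
      ultimately have den: "2 * (w (Suc i) - w i)\<^sup>2 = R\<^sup>2 / 8 * (9 / 16) ^ j"
        by (simp add: power_mult_distrib power_divide)
      have num: "2 ^ i * (norm a)\<^sup>2 = R\<^sup>2 / 144 * (1 / 2) ^ j"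
        unfolding a by (simp add: n Q_def power_add power_divide)
      have "(1 / 2 :: real) ^ j / (9 / 16) ^ j = (8 / 9) ^ j"
        by (simp flip: power_divide)
      then have "R\<^sup>2 / 144 * (1 / 2) ^ j / (R\<^sup>2 / 8 * (9 / 16) ^ j) = 1 / 18 * (8 / 9) ^ j"
        using \<open>0 < R\<close> by (simp add: power_divide)
      then show ?thesis
        unfolding j_def[symmetric] num den .
    qed
    then have "(\<Sum>i<n. 2 ^ i * (norm a)\<^sup>2 / (2 * (w (Suc i) - w i)\<^sup>2)) =
        (\<Sum>i<n. 1 / 18 * (8 / 9) ^ (n - Suc i))"
      by (intro sum.cong) auto
    also have "\<dots> = (\<Sum>i<n. 1 / 18 * (8 / 9) ^ i)"
      by (rule sum.nat_diff_reindex)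
    also have "\<dots> = 1 / 18 * ((1 - (8 / 9) ^ n) / (1 - 8 / 9))"
      unfolding sum_distrib_left[symmetric] by (subst sum_gp_strict) simp
    also have "\<dots> \<le> 1 / 2" by simp
    finally show ?thesis .
  qed
  have "f \<gamma> + 2 ^ n * (1 - (\<Sum>i<n. 2 ^ i * (norm a)\<^sup>2 / (2 * (w (Suc i) - w i)\<^sup>2))) * (\<kappa> / 2 * r\<^sup>2)
      - K * (2 ^ n * \<tau>) \<le> measure_pmf.expectation (walk \<tau> w a n \<gamma>) f"
  proof (rule walk_expectation_ge[OF walk w_less, of _ \<gamma> h R])
    show "0 \<le> \<kappa> / 2 * r\<^sup>2" using \<open>0 < \<kappa>\<close> by simp
    have "dist0 \<gamma> \<gamma> \<le> 0" by (rule dist0_least) simp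
    then show "dist0 \<gamma> \<gamma> \<le> R" using \<open>R > 0\<close> by simp
    show "norm (pend \<gamma> - pend \<gamma>) + w n \<le> R" by (simp add: w_eq)
  qed (use wait jump[OF _ _ _ r(1)] \<tau> in \<open>auto simp: a_def\<close>)
  moreover have "2 ^ n * (1 - (\<Sum>i<n. 2 ^ i * (norm a)\<^sup>2 / (2 * (w (Suc i) - w i)\<^sup>2))) * (\<kappa> / 2 * r\<^sup>2) =
      (1 - (\<Sum>i<n. 2 ^ i * (norm a)\<^sup>2 / (2 * (w (Suc i) - w i)\<^sup>2))) * (2 * G)"
    unfolding r(2) by (simp add: G_def)
  moreover have "1 / 2 * (2 * G) \<le>
      (1 - (\<Sum>i<n. 2 ^ i * (norm a)\<^sup>2 / (2 * (w (Suc i) - w i)\<^sup>2))) * (2 * G)"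
    using loss \<open>0 < Q\<close> \<open>0 < \<kappa>\<close> by (intro mult_right_mono) (auto simp: G_def)
  ultimately have E: "f \<gamma> + G - K * h \<le> measure_pmf.expectation (walk \<tau> w a n \<gamma>) f"
    unfolding \<tau>(2) by linarith
  obtain Y where Y: "Y \<in> set_pmf (walk \<tau> w a n \<gamma>)" "measure_pmf.expectation (walk \<tau> w a n \<gamma>) f \<le> f Y"
    using ex_ge_expectation_finite[OF finite_set_walk] by blast
  have ptime: "ptime Y = ptime \<gamma> + h" using ptime_walk[OF walk Y(1)] \<tau>(2) by simp
  show ?thesis
  proof (intro exI[of _ Y] conjI allI impI)
    show "pval Y t = pval \<gamma> t" if "0 \<le> t" "t \<le> ptime \<gamma>" for t
      using pval_walk_past[OF walk Y(1)] that by simp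
    show "norm (pval Y t - pend \<gamma>) \<le> R" if "ptime \<gamma> \<le> t" "t \<le> ptime \<gamma> + h" for t
      using walk_stays_near[OF walk Y(1), of t] that ptime by (simp add: w_eq)
    show "norm (pval Y t' - pval Y t) \<le> 3 * (R * (3 / 4) ^ k)"
      if "k \<le> n" "ptime \<gamma> \<le> t" "t \<le> t'" "t' \<le> ptime \<gamma> + h" "t' - t \<le> h / 2 ^ k" for k t t'
    proof -
      have "2 ^ (n - k) * \<tau> = h / 2 ^ k"
        using \<open>k \<le> n\<close> by (simp add: \<tau>_def power_diff)
      then show ?thesis
        using walk_modulus[OF walk Y(1), of "n - k" t t'] that ptime by (simp add: w_eq)
    qed
  qed (use ptime Y E in \<open>auto simp: G_def Q_def\<close>)
qed

text \<open>
  The step paths \<open>Y n\<close> share the past \<open>\<gamma>\<close> and a modulus \<open>\<omega>\<close> down to the scale \<open>h / 2 ^ n\<close>, which shrinks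
  with \<open>n\<close>; hence limits are continuous although the paths themselves jump.
\<close>

lemma equicontinuous_prolongations_converge:
  fixes Y :: "nat \<Rightarrow> 'd::finite path" and \<gamma> :: "'d path"
  assumes h: "0 < h" and \<gamma>: "continuous_on {0..ptime \<gamma>} (pval \<gamma>)"
    and \<omega>: "\<omega> \<longlonglongrightarrow> 0"
    and Y: "\<And>n. ptime (Y n) = ptime \<gamma> + h" "\<And>n t. 0 \<le> t \<Longrightarrow> t \<le> ptime \<gamma> \<Longrightarrow> pval (Y n) t = pval \<gamma> t"
      "\<And>n t. ptime \<gamma> \<le> t \<Longrightarrow> t \<le> ptime \<gamma> + h \<Longrightarrow> norm (pval (Y n) t - pend \<gamma>) \<le> R"
      "\<And>n k t t'. k \<le> n \<Longrightarrow> ptime \<gamma> \<le> t \<Longrightarrow> t \<le> t' \<Longrightarrow> t' \<le> ptime \<gamma> + h \<Longrightarrow> t' - t \<le> h / 2 ^ k \<Longrightarrow>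
        norm (pval (Y n) t' - pval (Y n) t) \<le> \<omega> k"
  obtains X k where "strict_mono (k :: nat \<Rightarrow> nat)" "ptime X = ptime \<gamma> + h" "continuous_on {0..ptime X} (pval X)"
    "(\<lambda>n. Y (k n)) \<longlonglongrightarrow> X"
proof -
  define s where "s = ptime \<gamma>"
  have s: "0 \<le> s" using ptime_nonneg by (simp add: s_def)
  note Y = Y[folded s_def]
  obtain g k where k: "strict_mono (k :: nat \<Rightarrow> nat)" and g: "continuous_on {s..s + h} g"
    and lim: "uniform_limit {s..s + h} (\<lambda>n. pval (Y (k n))) g sequentially"
  proof (rule asymptotic_Arzela_Ascoli[of "{s..s + h}" "\<lambda>n. pval (Y n)" "norm (pend \<gamma>) + R"])
    show "norm (pval (Y n) t) \<le> norm (pend \<gamma>) + R" if "t \<in> {s..s + h}" for n t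
      using Y(3)[of t n] that norm_triangle_sub[of "pval (Y n) t" "pend \<gamma>"] by (simp add: s_def)
    show "\<exists>d>0. \<exists>N. \<forall>n\<ge>N. \<forall>x\<in>{s..s + h}. \<forall>y\<in>{s..s + h}. dist x y < d \<longrightarrow>
        dist (pval (Y n) x) (pval (Y n) y) < \<epsilon>" if "\<epsilon> > 0" for \<epsilon>
    proof -
      have "\<forall>\<^sub>F k in sequentially. \<omega> k < \<epsilon>"
        using \<omega> \<open>\<epsilon> > 0\<close> by (rule order_tendstoD(2))
      then obtain k where k: "\<omega> k < \<epsilon>"
        by (auto simp: eventually_sequentially)
      have *: "dist (pval (Y n) x) (pval (Y n) y) < \<epsilon>"
        if "k \<le> n" "x \<in> {s..s + h}" "y \<in> {s..s + h}" "dist x y < h / 2 ^ k" "x \<le> y" for n x y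
        using Y(4)[of k n x y] k that by (simp add: dist_norm dist_real_def norm_minus_commute)
      show ?thesis
      proof (intro exI[of _ "h / 2 ^ k"] conjI exI[of _ k] allI ballI impI)
        fix n x y assume "k \<le> n" "x \<in> {s..s + h}" "y \<in> {s..s + h}" "dist x y < h / 2 ^ k"
        then show "dist (pval (Y n) x) (pval (Y n) y) < \<epsilon>"
          using *[of n x y] *[of n y x] by (cases "x \<le> y") (simp_all add: dist_commute)
      qed (use h in simp)
    qed
  qed simp_all

  define X0 where "X0 t = (if t \<le> s then pval \<gamma> t else g t)" for t
  have gs: "g s = pval \<gamma> s"
  proof -
    have "(\<lambda>n. pval (Y (k n)) s) \<longlonglongrightarrow> g s"
      using lim h by (intro tendsto_uniform_limitI) auto
    then show ?thesis using Y(2)[of s] s by (simp add: LIMSEQ_const_iff)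
  qed
  have "continuous_on ({0..s} \<union> {s..s + h}) X0"
    unfolding X0_def using \<gamma> g gs
    by (intro continuous_on_If) (auto simp: s_def)
  then have X0: "continuous_on {0..s + h} X0"
    using s h by (simp add: ivl_disj_un_two_touch)
  define X where "X = mk_path (s + h) X0"
  have X: "ptime X = s + h" "\<And>t. 0 \<le> t \<Longrightarrow> t \<le> s + h \<Longrightarrow> pval X t = X0 t"
    using continuous_on_imp_cadlag_on[OF X0] s h by (auto simp: X_def ptime_mk_path pval_mk_path)
  have "continuous_on {0..s + h} (pval X)"
    by (rule continuous_on_eq[OF X0]) (simp add: X)
  then have "continuous_on {0..ptime X} (pval X)" by (simp add: X)
  moreover have "(\<lambda>n. Y (k n)) \<longlonglongrightarrow> X"
  proof (rule metric_LIMSEQ_I)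
    fix \<epsilon> :: real assume "\<epsilon> > 0"
    then have "\<forall>\<^sub>F n in sequentially. \<forall>t\<in>{s..s + h}. dist (pval (Y (k n)) t) (g t) < \<epsilon> / 2"
      using uniform_limitD[OF lim, of "\<epsilon> / 2"] by simp
    then obtain N where N: "\<And>n t. n \<ge> N \<Longrightarrow> t \<in> {s..s + h} \<Longrightarrow> dist (pval (Y (k n)) t) (g t) < \<epsilon> / 2"
      unfolding eventually_sequentially by blast
    have "dist (Y (k n)) X < \<epsilon>" if "n \<ge> N" for n
    proof -
      have "dist0 (Y (k n)) X \<le> \<epsilon> / 2"
      proof (rule dist0_least)
        fix t :: real assume "0 \<le> t"
        then show "norm (pval (Y (k n)) (min t (ptime (Y (k n)))) - pval X (min t (ptime X))) \<le> \<epsilon> / 2"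
          using N[OF that, of "min t (s + h)"] s h Y(2)[of "min t (s + h)" "k n"] \<open>\<epsilon> > 0\<close>
          by (cases "min t (s + h) \<le> s") (auto simp: Y(1) X X0_def dist_norm min_le_iff_disj)
      qed
      then show ?thesis using \<open>\<epsilon> > 0\<close> by (simp add: dist_path_def Y(1) X)
    qed
    then show "\<exists>N. \<forall>n\<ge>N. dist (Y (k n)) X < \<epsilon>" by blast
  qed
  ultimately show ?thesis using that k X(1) s_def by blast
qed

text \<open>
  If the form were positive at \<open>\<gamma>\<close>, ascending step paths would converge to a continuous path with a
  positive value of \<open>f\<close>.
\<close>

lemma hessian_form_nonpos_of_max:
  fixes f :: "'d::finite path \<Rightarrow> real"
  assumes f: "path_C12 T (ptime \<gamma>) f ft fx fxx" and \<gamma>: "\<gamma> \<in> Lam T (ptime \<gamma>)" "ptime \<gamma> < T"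
    and zero: "f \<gamma> = 0" and max: "\<And>\<eta>. \<eta> \<in> Lam T (ptime \<gamma>) \<Longrightarrow> f \<eta> \<le> 0"
  shows "(\<Sum>i\<in>UNIV. \<Sum>j\<in>UNIV. e $ i * e $ j * fxx i j \<gamma>) \<le> 0"
proof (rule ccontr)
  define s where "s = ptime \<gamma>"
  define q where "q \<eta> = (\<Sum>i\<in>UNIV. \<Sum>j\<in>UNIV. e $ i * e $ j * fxx i j \<eta>)" for \<eta>
  define \<kappa> where "\<kappa> = q \<gamma>"
  define K where "K = \<bar>ft \<gamma>\<bar> + 1"
  assume "\<not> ?thesis"
  then have "\<kappa> > 0" by (simp add: \<kappa>_def q_def)
  have "e \<noteq> 0"
  proof
    assume "e = 0"
    then have "\<kappa> = 0" by (simp add: \<kappa>_def q_def)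
    with \<open>\<kappa> > 0\<close> show False by simp
  qed
  have "K > 0" by (simp add: K_def)
  have s: "0 \<le> s" "s < T" using \<gamma> ptime_nonneg by (auto simp: s_def)
  have \<gamma>_hat: "\<gamma> \<in> Lam_hat T s" using \<gamma> Lam_subset_Lam_hat by (auto simp: s_def)

  have "continuous_on (Lam_hat T s) q"
    unfolding q_def s_def using path_C12_continuous[OF f] by (intro continuous_intros) auto
  then obtain \<delta>1 where \<delta>1: "\<delta>1 > 0" "\<And>\<eta>. \<eta> \<in> Lam_hat T s \<Longrightarrow> dist \<eta> \<gamma> < \<delta>1 \<Longrightarrow> dist (q \<eta>) (q \<gamma>) < \<kappa> / 2"
    using \<gamma>_hat \<open>\<kappa> > 0\<close> unfolding continuous_on_iff by (meson half_gt_zero)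
  obtain \<delta>2 where \<delta>2: "\<delta>2 > 0" "\<And>\<eta>. \<eta> \<in> Lam_hat T s \<Longrightarrow> dist \<eta> \<gamma> < \<delta>2 \<Longrightarrow> dist (ft \<eta>) (ft \<gamma>) < 1"
    using path_C12_continuous(2)[OF f] \<gamma>_hat unfolding continuous_on_iff s_def by (meson zero_less_one)
  define \<delta> where "\<delta> = min \<delta>1 \<delta>2"
  have "\<delta> > 0" using \<delta>1 \<delta>2 by (simp add: \<delta>_def)
  define R where "R = \<delta> / 4"
  define G where "G = \<kappa> / 2 * R\<^sup>2 / (288 * (norm e)\<^sup>2)"
  have "R > 0" using \<open>\<delta> > 0\<close> by (auto simp: R_def)
  then have "G > 0" using \<open>\<kappa> > 0\<close> \<open>e \<noteq> 0\<close> by (simp add: G_def)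
  \<comment> \<open>Short enough that waiting costs at most half of the gain \<open>G\<close>, that the horizon is not reached,
      and that the paths stay in the \<open>\<delta>\<close>-ball.\<close>
  define h where "h = min (\<delta> / 4) (min ((T - s) / 2) (G / (2 * K)))"
  have h: "h > 0" "h \<le> \<delta> / 4" "s + h < T" "K * h \<le> G / 2"
  proof -
    show "h > 0" using \<open>\<delta> > 0\<close> s \<open>G > 0\<close> \<open>K > 0\<close> by (simp add: h_def)
    show "h \<le> \<delta> / 4" by (simp add: h_def)
    have "h \<le> (T - s) / 2" unfolding h_def by linarith
    then show "s + h < T" using s by simp
    have "h \<le> G / (2 * K)" unfolding h_def by linarith
    then show "K * h \<le> G / 2" using \<open>K > 0\<close> by (simp add: field_simps)
  qed
  have dist_\<gamma>: "dist Y \<gamma> = \<bar>s - ptime Y\<bar> + dist0 \<gamma> Y" for Y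
    by (subst dist_commute) (simp add: dist_path_def s_def)
  have ball: "Y \<in> Lam_hat T s \<and> dist Y \<gamma> < \<delta>" if "s \<le> ptime Y" "ptime Y \<le> s + h" "dist0 \<gamma> Y \<le> R" for Y
    using that h \<open>\<delta> > 0\<close> by (auto simp: Lam_hat_def dist_\<gamma> R_def)
  have dist0_prolong: "dist0 \<gamma> (prolong r Y) \<le> R" if "dist0 \<gamma> Y \<le> R" "ptime Y \<le> r" for r Y
  proof (rule dist0_least)
    fix t :: real assume t: "0 \<le> t"
    then have "pval (prolong r Y) (min t (ptime (prolong r Y))) = pval Y (min t (ptime Y))"
      using that ptime_nonneg[of Y] by (auto simp: ptime_prolong pval_prolong min_def)
    then show "norm (pval \<gamma> (min t (ptime \<gamma>)) - pval (prolong r Y) (min t (ptime (prolong r Y)))) \<le> R"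
      using dist0_upper[OF t, of \<gamma> Y] that by simp
  qed
  have dist0_bump: "dist0 \<gamma> (bump Y x) \<le> R"
    if "dist0 \<gamma> Y \<le> R" "norm (pend Y - pend \<gamma>) + norm x \<le> R" "s \<le> ptime Y" for x Y
  proof (rule dist0_least)
    fix t :: real assume t: "0 \<le> t"
    show "norm (pval \<gamma> (min t (ptime \<gamma>)) - pval (bump Y x) (min t (ptime (bump Y x)))) \<le> R"
    proof (cases "t < ptime Y")
      case True
      then show ?thesis using dist0_upper[OF t, of \<gamma> Y] that t by (simp add: ptime_bump pval_bump)
    next
      case False
      then have "min t (ptime \<gamma>) = ptime \<gamma>" using that(3) by (simp add: s_def)
      moreover have "norm (pend \<gamma> - (pend Y + x)) \<le> norm (pend Y - pend \<gamma>) + norm x"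
        using norm_triangle_ineq4[of "pend \<gamma> - pend Y" x] by (simp add: norm_minus_commute algebra_simps)
      ultimately show ?thesis using False that(2) by (simp add: ptime_bump pend_bump[unfolded ptime_bump])
    qed
  qed
  have wait: "f Y - K * (r - ptime Y) \<le> f (prolong r Y)"
    if "s \<le> ptime Y" "ptime Y \<le> r" "r \<le> s + h" "dist0 \<gamma> Y \<le> R" for Y r
  proof -
    have "Y \<in> Lam_hat T s" using ball that by simp
    moreover have "- K < ft (prolong r' Y)" if r': "ptime Y \<le> r'" "r' < r" for r'
    proof -
      have "prolong r' Y \<in> Lam_hat T s \<and> dist (prolong r' Y) \<gamma> < \<delta>"
        using dist0_prolong \<open>s \<le> ptime Y\<close> \<open>r \<le> s + h\<close> \<open>dist0 \<gamma> Y \<le> R\<close> r'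
        by (intro ball) (auto simp: ptime_prolong)
      then have "dist (ft (prolong r' Y)) (ft \<gamma>) < 1"
        using \<delta>2(2) by (simp add: \<delta>_def)
      then show ?thesis by (simp add: K_def dist_real_def)
    qed
    ultimately show ?thesis
      using path_C12_prolong_ge[OF f[folded s_def], of Y r "- K"] that h by simp
  qed
  have jump: "2 * f Y + \<kappa> / 2 * r\<^sup>2 \<le> f (bump Y (r *\<^sub>R e)) + f (bump Y (- (r *\<^sub>R e)))"
    if Y: "s \<le> ptime Y" "ptime Y \<le> s + h" "dist0 \<gamma> Y \<le> R" and "0 \<le> r"
      and r: "norm (pend Y - pend \<gamma>) + norm (r *\<^sub>R e) \<le> R" for Y r
  proof -
    have "\<kappa> / 2 \<le> q (bump Y (x *\<^sub>R e))" if x: "\<bar>x\<bar> \<le> r" for x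
    proof -
      have "norm (x *\<^sub>R e) \<le> norm (r *\<^sub>R e)"
        using x by (simp add: mult_right_mono)
      then have "bump Y (x *\<^sub>R e) \<in> Lam_hat T s \<and> dist (bump Y (x *\<^sub>R e)) \<gamma> < \<delta>"
        using Y r dist0_bump by (intro ball) (auto simp: ptime_bump)
      then have "dist (q (bump Y (x *\<^sub>R e))) (q \<gamma>) < \<kappa> / 2"
        using \<delta>1(2) by (simp add: \<delta>_def)
      then show ?thesis unfolding \<kappa>_def[symmetric] dist_real_def by linarith
    qed
    then show ?thesis
      using path_C12_symmetric_bump_ge[OF f[folded s_def] _ \<open>0 \<le> r\<close>, of Y "\<kappa> / 2" e] ball[OF Y]
      by (simp add: q_def)
  qed

  have "\<exists>Y. ptime Y = s + h \<and> (\<forall>t. 0 \<le> t \<longrightarrow> t \<le> s \<longrightarrow> pval Y t = pval \<gamma> t) \<and>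
      (\<forall>t. s \<le> t \<longrightarrow> t \<le> s + h \<longrightarrow> norm (pval Y t - pend \<gamma>) \<le> R) \<and>
      (\<forall>k\<le>n. \<forall>t t'. s \<le> t \<longrightarrow> t \<le> t' \<longrightarrow> t' \<le> s + h \<longrightarrow> t' - t \<le> h / 2 ^ k \<longrightarrow>
        norm (pval Y t' - pval Y t) \<le> 3 * (R * (3 / 4) ^ k)) \<and>
      f \<gamma> + G - K * h \<le> f Y" for n
    unfolding G_def s_def
    by (rule ascending_path_exists[OF h(1) \<open>R > 0\<close> _ \<open>e \<noteq> 0\<close> wait[unfolded s_def] jump[unfolded s_def]])
      (use \<open>\<kappa> > 0\<close> in simp_all)
  then obtain Y where Y: "\<And>n. ptime (Y n) = s + h" "\<And>n t. 0 \<le> t \<Longrightarrow> t \<le> s \<Longrightarrow> pval (Y n) t = pval \<gamma> t"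
      "\<And>n t. s \<le> t \<Longrightarrow> t \<le> s + h \<Longrightarrow> norm (pval (Y n) t - pend \<gamma>) \<le> R"
      "\<And>n k t t'. k \<le> n \<Longrightarrow> s \<le> t \<Longrightarrow> t \<le> t' \<Longrightarrow> t' \<le> s + h \<Longrightarrow> t' - t \<le> h / 2 ^ k \<Longrightarrow>
        norm (pval (Y n) t' - pval (Y n) t) \<le> 3 * (R * (3 / 4) ^ k)"
      "\<And>n. f \<gamma> + G - K * h \<le> f (Y n)"
    by metis
  have \<omega>: "(\<lambda>k. 3 * (R * (3 / 4) ^ k)) \<longlonglongrightarrow> 0"
    by (intro tendsto_mult_right_zero LIMSEQ_power_zero) simp
  obtain X k where X: "strict_mono (k :: nat \<Rightarrow> nat)" "ptime X = s + h"
      "continuous_on {0..ptime X} (pval X)" "(\<lambda>n. Y (k n)) \<longlonglongrightarrow> X"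
    unfolding s_def
    by (rule equicontinuous_prolongations_converge[OF h(1) _ \<omega> Y(1-4)[unfolded s_def]])
      (use \<gamma> in \<open>auto simp: Lam_def\<close>)
  then have X_Lam: "X \<in> Lam T s" using h by (simp add: Lam_def)
  have "(\<lambda>n. f (Y (k n))) \<longlonglongrightarrow> f X"
    using X(4) X_Lam Lam_subset_Lam_hat[of T s] h
    by (intro continuous_on_tendsto_compose[OF path_C12_continuous(1)[OF f]])
      (auto simp: Lam_hat_def Y(1) s_def[symmetric])
  moreover have "\<forall>n. G / 2 \<le> f (Y (k n))"
  proof
    show "G / 2 \<le> f (Y (k n))" for n using Y(5)[of "k n"] zero h(4) by simp
  qed
  ultimately have "G / 2 \<le> f X"
    by (intro LIMSEQ_le_const) auto
  with max[of X] X_Lam \<open>G > 0\<close> show False by (simp add: s_def)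
qed

text \<open>
  The Hessian condition for \<open>exp (l f) - 1\<close> on the diagonal reads
  \<open>l * (fxx i i \<gamma> + l * (fx i \<gamma>)\<^sup>2) \<le> 0\<close> for every \<open>l > 0\<close>.
\<close>

lemma gradient_zero_of_max:
  assumes f: "path_C12 T (ptime \<gamma>) f ft fx fxx" and \<gamma>: "\<gamma> \<in> Lam T (ptime \<gamma>)" "ptime \<gamma> < T"
    and zero: "f \<gamma> = 0" and max: "\<And>\<eta>. \<eta> \<in> Lam T (ptime \<gamma>) \<Longrightarrow> f \<eta> \<le> 0"
  shows "fx i \<gamma> = 0"
proof -
  have le: "l * (fxx i i \<gamma> + l * (fx i \<gamma>)\<^sup>2) \<le> 0" if "l > 0" for l
  proof -
    have "(\<Sum>k\<in>UNIV. \<Sum>j\<in>UNIV. axis i 1 $ k * axis i 1 $ j *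
        (l * exp (l * f \<gamma>) * (fxx k j \<gamma> + l * fx k \<gamma> * fx j \<gamma>))) \<le> 0"
      by (rule hessian_form_nonpos_of_max[OF path_C12_exp[OF f] \<gamma>])
        (use zero max that in \<open>auto simp: mult_nonneg_nonpos\<close>)
    moreover have "(\<Sum>k\<in>UNIV. \<Sum>j\<in>UNIV. axis i 1 $ k * axis i 1 $ j * F k j) = F i i" for F :: "'a \<Rightarrow> 'a \<Rightarrow> real"
      by (simp add: axis_def if_distrib[of "\<lambda>x. x * _"] if_distrib[of "\<lambda>x. _ * x"] cong: if_cong)
    ultimately show ?thesis by (simp add: zero power2_eq_square mult.assoc)
  qed
  have "l * (fx i \<gamma>)\<^sup>2 \<le> - fxx i i \<gamma>" if "l > 0" for l
    using le[OF that] that by (simp add: mult_le_0_iff)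
  from this[of "(\<bar>fxx i i \<gamma>\<bar> + 1) / (fx i \<gamma>)\<^sup>2"] show ?thesis
    by (cases "fx i \<gamma> = 0") (auto simp: divide_pos_pos abs_if split: if_splits)
qed

text \<open>
  Prolonging a continuous path by its last value keeps it continuous.
\<close>

lemma dt_nonpos_of_max:
  assumes f: "path_C12 T (ptime \<gamma>) f ft fx fxx" and \<gamma>: "\<gamma> \<in> Lam T (ptime \<gamma>)" "ptime \<gamma> < T"
    and zero: "f \<gamma> = 0" and max: "\<And>\<eta>. \<eta> \<in> Lam T (ptime \<gamma>) \<Longrightarrow> f \<eta> \<le> 0"
  shows "ft \<gamma> \<le> 0"
proof (rule tendsto_upperbound)
  show "(dt_quot f \<gamma> \<longlongrightarrow> ft \<gamma>) (at_right 0)"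
    by (rule path_C12_dt[OF f]) (use \<gamma> Lam_subset_Lam_hat in auto)
  have "\<forall>\<^sub>F h in at_right 0. 0 < h \<and> h < T - ptime \<gamma>"
    using \<gamma>(2) by (intro eventually_at_rightI[of 0 "T - ptime \<gamma>"]) auto
  then show "\<forall>\<^sub>F h in at_right 0. dt_quot f \<gamma> h \<le> 0"
  proof eventually_elim
    case (elim h)
    then have "f (prolong (ptime \<gamma> + h) \<gamma>) \<le> 0"
      by (intro max prolong_in_Lam \<gamma>) auto
    with elim show ?case by (simp add: dt_quot_def zero divide_nonpos_pos)
  qed
qed simp

section \<open>Comparison of the operators at a point of contact\<close>

text \<open>
  The second order term of the Hamiltonian only sees the quadratic form of \<open>A\<close>, evaluated at the
  columns of the diffusion matrix \<open>S\<close>.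
\<close>

lemma trace_mult_gram:
  fixes A :: "real^'d::finite^'d" and S :: "real^'n::finite^'d"
  shows "trace (A ** (S ** transpose S)) = (\<Sum>k\<in>UNIV. \<Sum>i\<in>UNIV. \<Sum>j\<in>UNIV. S $ i $ k * S $ j $ k * A $ i $ j)"
proof -
  have "trace (A ** (S ** transpose S)) = (\<Sum>i\<in>UNIV. \<Sum>j\<in>UNIV. \<Sum>k\<in>UNIV. S $ i $ k * S $ j $ k * A $ i $ j)"
    by (simp add: trace_def matrix_matrix_mult_def transpose_def sum_distrib_left mult_ac)
  also have "\<dots> = (\<Sum>i\<in>UNIV. \<Sum>k\<in>UNIV. \<Sum>j\<in>UNIV. S $ i $ k * S $ j $ k * A $ i $ j)"
    by (intro sum.cong refl sum.swap)
  also have "\<dots> = (\<Sum>k\<in>UNIV. \<Sum>i\<in>UNIV. \<Sum>j\<in>UNIV. S $ i $ k * S $ j $ k * A $ i $ j)"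
    by (rule sum.swap)
  finally show ?thesis .
qed

text \<open>
  The linear growth conditions bound all coefficients at a fixed path uniformly in the control. The
  supremum in a conditionally complete order is monotone only on bounded sets.
\<close>

lemma Ham_bdd_above:
  assumes H: "hyp_H T b \<sigma> q \<phi>" and \<gamma>: "\<gamma> \<in> Lam T 0"
  shows "bdd_above (range (\<lambda>u. p \<bullet> b \<gamma> u + 1 / 2 * trace (A ** (\<sigma> \<gamma> u ** transpose (\<sigma> \<gamma> u)))
             + q \<gamma> r (transpose (\<sigma> \<gamma> u) *v p) u))"
proof -
  obtain L where "L > 0"
    and "\<forall>\<gamma>\<in>Lam T 0. \<forall>u. max ((norm (b \<gamma> u))\<^sup>2) ((norm (\<sigma> \<gamma> u))\<^sup>2) \<le> L\<^sup>2 * (1 + (norm0 \<gamma>)\<^sup>2)"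
    and "\<forall>\<gamma>\<in>Lam T 0. \<forall>y z u. \<bar>q \<gamma> y z u\<bar> \<le> L * (1 + norm0 \<gamma> + \<bar>y\<bar> + norm z)"
    using H unfolding hyp_H_def by (elim conjE exE) (rule that; assumption)
  with \<gamma> have L: "L > 0" "\<And>u. max ((norm (b \<gamma> u))\<^sup>2) ((norm (\<sigma> \<gamma> u))\<^sup>2) \<le> L\<^sup>2 * (1 + (norm0 \<gamma>)\<^sup>2)"
    "\<And>y z u. \<bar>q \<gamma> y z u\<bar> \<le> L * (1 + norm0 \<gamma> + \<bar>y\<bar> + norm z)"
    by simp_all
  define M where "M = L * sqrt (1 + (norm0 \<gamma>)\<^sup>2)"
  have "(norm (b \<gamma> u))\<^sup>2 \<le> M\<^sup>2 \<and> (norm (\<sigma> \<gamma> u))\<^sup>2 \<le> M\<^sup>2" for u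
    using L(2)[of u] by (simp add: M_def power_mult_distrib)
  moreover have "M \<ge> 0" using L(1) by (simp add: M_def)
  ultimately have b: "norm (b \<gamma> u) \<le> M" and s: "norm (\<sigma> \<gamma> u) \<le> M" for u
    using power2_le_imp_le by blast+
  have entry: "\<bar>\<sigma> \<gamma> u $ i $ k\<bar> \<le> M" for u i k
    using component_le_norm_cart[of "\<sigma> \<gamma> u $ i" k] Finite_Cartesian_Product.norm_nth_le[of "\<sigma> \<gamma> u" i] s[of u] by linarith
  define C where "C = (\<Sum>k\<in>(UNIV :: 'c set). \<Sum>i\<in>UNIV. \<Sum>j\<in>UNIV. M * M * \<bar>A $ i $ j\<bar>)"
  define D where "D = (\<Sum>k\<in>(UNIV :: 'c set). \<Sum>i\<in>UNIV. M * \<bar>p $ i\<bar>)"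
  have tr: "trace (A ** (\<sigma> \<gamma> u ** transpose (\<sigma> \<gamma> u))) \<le> C" for u
    unfolding trace_mult_gram C_def
  proof (intro sum_mono)
    fix k i j
    have "\<bar>\<sigma> \<gamma> u $ i $ k * \<sigma> \<gamma> u $ j $ k * A $ i $ j\<bar> \<le> M * M * \<bar>A $ i $ j\<bar>"
      unfolding abs_mult by (intro mult_mono entry) (use \<open>M \<ge> 0\<close> in auto)
    then show "\<sigma> \<gamma> u $ i $ k * \<sigma> \<gamma> u $ j $ k * A $ i $ j \<le> M * M * \<bar>A $ i $ j\<bar>" by linarith
  qed
  have z: "norm (transpose (\<sigma> \<gamma> u) *v p) \<le> D" for u
  proof -
    have "norm (transpose (\<sigma> \<gamma> u) *v p) \<le> (\<Sum>k\<in>UNIV. \<bar>(transpose (\<sigma> \<gamma> u) *v p) $ k\<bar>)"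
      by (rule norm_le_l1_cart)
    also have "\<dots> \<le> D"
      unfolding D_def
    proof (rule sum_mono)
      fix k
      have "\<bar>(transpose (\<sigma> \<gamma> u) *v p) $ k\<bar> \<le> (\<Sum>i\<in>UNIV. \<bar>\<sigma> \<gamma> u $ i $ k * p $ i\<bar>)"
        by (simp add: matrix_vector_mult_def transpose_def)
      also have "\<dots> \<le> (\<Sum>i\<in>UNIV. M * \<bar>p $ i\<bar>)"
        by (intro sum_mono) (simp add: abs_mult mult_right_mono entry)
      finally show "\<bar>(transpose (\<sigma> \<gamma> u) *v p) $ k\<bar> \<le> (\<Sum>i\<in>UNIV. M * \<bar>p $ i\<bar>)" .
    qed
    finally show ?thesis .
  qed
  show ?thesis
  proof (rule bdd_aboveI2)
    fix u
    have "p \<bullet> b \<gamma> u \<le> norm p * M"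
      using norm_cauchy_schwarz[of p "b \<gamma> u"] mult_left_mono[OF b norm_ge_zero] by (rule order_trans)
    moreover have "q \<gamma> r (transpose (\<sigma> \<gamma> u) *v p) u \<le> L * (1 + norm0 \<gamma> + \<bar>r\<bar> + D)"
    proof -
      have "L * (1 + norm0 \<gamma> + \<bar>r\<bar> + norm (transpose (\<sigma> \<gamma> u) *v p)) \<le> L * (1 + norm0 \<gamma> + \<bar>r\<bar> + D)"
        using z[of u] L(1) by simp
      then show ?thesis using L(3)[of r "transpose (\<sigma> \<gamma> u) *v p" u] by linarith
    qed
    ultimately show "p \<bullet> b \<gamma> u + 1 / 2 * trace (A ** (\<sigma> \<gamma> u ** transpose (\<sigma> \<gamma> u)))
             + q \<gamma> r (transpose (\<sigma> \<gamma> u) *v p) u \<le> norm p * M + 1 / 2 * C + L * (1 + norm0 \<gamma> + \<bar>r\<bar> + D)"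
      using tr[of u] by simp
  qed
qed

lemma Ham_mono_hessian:
  assumes "hyp_H T b \<sigma> q \<phi>" "\<gamma> \<in> Lam T 0"
    and le: "\<And>e. (\<Sum>i\<in>UNIV. \<Sum>j\<in>UNIV. e $ i * e $ j * A $ i $ j) \<le> (\<Sum>i\<in>UNIV. \<Sum>j\<in>UNIV. e $ i * e $ j * B $ i $ j)"
  shows "Ham b \<sigma> q \<gamma> r p A \<le> Ham b \<sigma> q \<gamma> r p B"
  unfolding Ham_def
proof (rule cSUP_mono)
  fix u
  have "trace (A ** (\<sigma> \<gamma> u ** transpose (\<sigma> \<gamma> u))) \<le> trace (B ** (\<sigma> \<gamma> u ** transpose (\<sigma> \<gamma> u)))"
    unfolding trace_mult_gram
  proof (rule sum_mono)
    fix k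
    show "(\<Sum>i\<in>UNIV. \<Sum>j\<in>UNIV. \<sigma> \<gamma> u $ i $ k * \<sigma> \<gamma> u $ j $ k * A $ i $ j) \<le>
        (\<Sum>i\<in>UNIV. \<Sum>j\<in>UNIV. \<sigma> \<gamma> u $ i $ k * \<sigma> \<gamma> u $ j $ k * B $ i $ j)"
      using le[of "\<chi> i. \<sigma> \<gamma> u $ i $ k"] by simp
  qed
  then show "\<exists>u'\<in>UNIV. p \<bullet> b \<gamma> u + 1 / 2 * trace (A ** (\<sigma> \<gamma> u ** transpose (\<sigma> \<gamma> u)))
        + q \<gamma> r (transpose (\<sigma> \<gamma> u) *v p) u
      \<le> p \<bullet> b \<gamma> u' + 1 / 2 * trace (B ** (\<sigma> \<gamma> u' ** transpose (\<sigma> \<gamma> u')))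
        + q \<gamma> r (transpose (\<sigma> \<gamma> u') *v p) u'"
    by (intro bexI[of _ u]) auto
qed (use Ham_bdd_above[OF assms(1,2)] in auto)

lemma some_ext_extends:
  assumes "f \<in> C12p T t"
  shows "extends_on T t f (some_ext T t f)"
proof -
  have "\<exists>g. extends_on T t f g" using assms by (simp add: C12p_def)
  then show ?thesis unfolding some_ext_def by (rule someI_ex)
qed

text \<open>
  The functionals may be given from different initial times \<open>t\<close> and \<open>t'\<close> up to the time of contact. The
  case \<open>f = g\<close> with \<open>t\<close> and \<open>t'\<close> exchanged shows that \<^const>\<open>LL\<close> is independent of the chosen extension.
\<close>

lemma LL_mono_of_contact:
  assumes H: "hyp_H T b \<sigma> q \<phi>" and \<gamma>: "\<gamma> \<in> Lam T 0" "ptime \<gamma> < T"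
    and f: "f \<in> C12p T t" "t \<le> ptime \<gamma>" and g: "g \<in> C12p T t'" "t' \<le> ptime \<gamma>"
    and eq: "f \<gamma> = g \<gamma>" and le: "\<And>\<eta>. \<eta> \<in> Lam T (ptime \<gamma>) \<Longrightarrow> f \<eta> \<le> g \<eta>"
  shows "LL T b \<sigma> q t f \<gamma> \<le> LL T b \<sigma> q t' g \<gamma>"
proof -
  define F where "F = some_ext T t f"
  define G where "G = some_ext T t' g"
  define s where "s = ptime \<gamma>"
  have F: "F \<in> C12p_hat T t" "\<And>\<eta>. \<eta> \<in> Lam T s \<Longrightarrow> F \<eta> = f \<eta>"
    using some_ext_extends[OF f(1)] f(2) by (auto simp: F_def s_def extends_on_def Lam_def)
  have G: "G \<in> C12p_hat T t'" "\<And>\<eta>. \<eta> \<in> Lam T s \<Longrightarrow> G \<eta> = g \<eta>"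
    using some_ext_extends[OF g(1)] g(2) by (auto simp: G_def s_def extends_on_def Lam_def)
  have \<gamma>s: "\<gamma> \<in> Lam T s" using \<gamma> by (simp add: Lam_def s_def)
  note D = path_C12_diff[OF path_C12_subset[OF C12p_hat_path_C12[OF F(1)] f(2)]
      path_C12_subset[OF C12p_hat_path_C12[OF G(1)] g(2)]]
  have zero: "F \<gamma> - G \<gamma> = 0" using F(2) G(2) \<gamma>s eq by simp
  have max: "F \<eta> - G \<eta> \<le> 0" if "\<eta> \<in> Lam T (ptime \<gamma>)" for \<eta>
    using F(2) G(2) le that by (simp add: s_def)
  note contact = D \<gamma>s[unfolded s_def] \<gamma>(2) zero max
  have "Dt T t f \<gamma> \<le> Dt T t' g \<gamma>"
    using dt_nonpos_of_max[OF contact] by (simp add: Dt_def F_def G_def)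
  moreover have "Dx T t f \<gamma> = Dx T t' g \<gamma>"
    using gradient_zero_of_max[OF contact] by (simp add: Dx_def F_def G_def vec_eq_iff)
  moreover have "Ham b \<sigma> q \<gamma> r p (Dxx T t f \<gamma>) \<le> Ham b \<sigma> q \<gamma> r p (Dxx T t' g \<gamma>)" for r p
  proof (rule Ham_mono_hessian[OF H \<gamma>(1)])
    fix e :: "real^'a"
    have "(\<Sum>i\<in>UNIV. \<Sum>j\<in>UNIV. e $ i * e $ j * (dx (dx F j) i \<gamma> - dx (dx G j) i \<gamma>)) \<le> 0"
      by (rule hessian_form_nonpos_of_max[OF contact])
    then show "(\<Sum>i\<in>UNIV. \<Sum>j\<in>UNIV. e $ i * e $ j * Dxx T t f \<gamma> $ i $ j) \<le>
        (\<Sum>i\<in>UNIV. \<Sum>j\<in>UNIV. e $ i * e $ j * Dxx T t' g \<gamma> $ i $ j)"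
      by (simp add: Dxx_def F_def G_def right_diff_distrib sum_subtractf)
  qed
  ultimately show ?thesis
    using eq by (simp add: LL_def add_mono)
qed

section \<open>Classical and viscosity solutions\<close>

lemma C12p_antimono: "t \<le> t' \<Longrightarrow> C12p T t \<subseteq> C12p T t'"
  using C12p_hat_antimono[of t t' T] unfolding C12p_def extends_on_def Lam_def by fastforce

lemma C12p_imp_continuous_on: "f \<in> C12p T t \<Longrightarrow> continuous_on (Lam T t) f"
proof -
  assume "f \<in> C12p T t"
  then obtain g where g: "g \<in> C12p_hat T t" "\<And>\<eta>. \<eta> \<in> Lam T t \<Longrightarrow> g \<eta> = f \<eta>"
    by (auto simp: C12p_def extends_on_def)
  have "continuous_on (Lam T t) g"
    using path_C12_continuous(1)[OF C12p_hat_path_C12[OF g(1)]] Lam_subset_Lam_hat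
    by (rule continuous_on_subset)
  then show ?thesis using g(2) by (rule continuous_on_eq)
qed

lemma continuous_on_imp_usc_on: "continuous_on S f \<Longrightarrow> usc_on S f"
  and continuous_on_imp_lsc_on: "continuous_on S f \<Longrightarrow> lsc_on S f"
  by (auto simp: usc_on_def lsc_on_def continuous_on_def intro: order_tendstoD)

lemma test_aboveD:
  assumes "f \<in> test_above T \<gamma> w"
  shows "f \<in> C12p T (ptime \<gamma>)" "w \<gamma> = f \<gamma>" "\<eta> \<in> Lam T (ptime \<gamma>) \<Longrightarrow> w \<eta> \<le> f \<eta>"
proof -
  have *: "f \<in> C12p T (ptime \<gamma>)" "0 = w \<gamma> - f \<gamma>"
      "ereal (w \<gamma> - f \<gamma>) = (SUP \<eta>\<in>Lam T (ptime \<gamma>). ereal (w \<eta> - f \<eta>))"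
    using assms unfolding test_above_def by blast+
  then show "f \<in> C12p T (ptime \<gamma>)" "w \<gamma> = f \<gamma>" by simp_all
  assume "\<eta> \<in> Lam T (ptime \<gamma>)"
  then have "ereal (w \<eta> - f \<eta>) \<le> ereal (w \<gamma> - f \<gamma>)"
    unfolding *(3) by (rule SUP_upper)
  with *(2) show "w \<eta> \<le> f \<eta>" by simp
qed

lemma test_belowD:
  assumes "f \<in> test_below T \<gamma> w"
  shows "f \<in> C12p T (ptime \<gamma>)" "w \<gamma> = f \<gamma>" "\<eta> \<in> Lam T (ptime \<gamma>) \<Longrightarrow> f \<eta> \<le> w \<eta>"
proof -
  have *: "f \<in> C12p T (ptime \<gamma>)" "0 = w \<gamma> - f \<gamma>"
      "ereal (w \<gamma> - f \<gamma>) = (INF \<eta>\<in>Lam T (ptime \<gamma>). ereal (w \<eta> - f \<eta>))"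
    using assms unfolding test_below_def by blast+
  then show "f \<in> C12p T (ptime \<gamma>)" "w \<gamma> = f \<gamma>" by simp_all
  assume "\<eta> \<in> Lam T (ptime \<gamma>)"
  then have "ereal (w \<gamma> - f \<gamma>) \<le> ereal (w \<eta> - f \<eta>)"
    unfolding *(3) by (rule INF_lower)
  with *(2) show "f \<eta> \<le> w \<eta>" by simp
qed

lemma C12p_tests_itself:
  fixes v :: "'d::finite path \<Rightarrow> real"
  assumes "v \<in> C12p T 0" "\<gamma> \<in> Lam T 0"
  shows "v \<in> test_above T \<gamma> v" "v \<in> test_below T \<gamma> v"
proof -
  have v: "v \<in> C12p T (ptime \<gamma>)"
    using C12p_antimono[OF ptime_nonneg] assms(1) by blast
  have "\<gamma> \<in> Lam T (ptime \<gamma>)"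
    using assms(2) by (simp add: Lam_def)
  then have ne: "(Lam T (ptime \<gamma>) :: 'd path set) \<noteq> {}" by blast
  show "v \<in> test_above T \<gamma> v"
    unfolding test_above_def mem_Collect_eq diff_self
    using v SUP_const[OF ne] by metis
  show "v \<in> test_below T \<gamma> v"
    unfolding test_below_def mem_Collect_eq diff_self
    using v INF_const[OF ne] by metis
qed

theorem theorem4p6:
  fixes T :: real
    and b :: "'d::finite path \<Rightarrow> 'u::polish_space \<Rightarrow> real^'d"
    and \<sigma> :: "'d path \<Rightarrow> 'u \<Rightarrow> real^'n::finite^'d"
    and q :: "'d path \<Rightarrow> real \<Rightarrow> real^'n \<Rightarrow> 'u \<Rightarrow> real"
    and \<phi> :: "'d path \<Rightarrow> real"
    and v :: "'d path \<Rightarrow> real"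
  assumes "0 < T"
    and "hyp_H T b \<sigma> q \<phi>"
    and "v \<in> C12p T 0"
  shows "(classical_solution T b \<sigma> q \<phi> v \<longleftrightarrow> viscosity_solution T b \<sigma> q \<phi> v) \<and>
    (classical_subsolution T b \<sigma> q \<phi> v \<longleftrightarrow> viscosity_subsolution T b \<sigma> q \<phi> v) \<and>
    (classical_supersolution T b \<sigma> q \<phi> v \<longleftrightarrow> viscosity_supersolution T b \<sigma> q \<phi> v)"
proof -
  note v = \<open>v \<in> C12p T 0\<close>
  have cont: "continuous_on (Lam T 0) v"
    by (rule C12p_imp_continuous_on[OF v])
  have above: "LL T b \<sigma> q 0 v \<gamma> \<le> LL T b \<sigma> q (ptime \<gamma>) f \<gamma>"
    if "\<gamma> \<in> Lam T 0" "ptime \<gamma> < T" "f \<in> test_above T \<gamma> v" for \<gamma> f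
    by (rule LL_mono_of_contact[OF assms(2) that(1,2) v ptime_nonneg test_aboveD(1)[OF that(3)]
          order_refl test_aboveD(2,3)[OF that(3)]])
  have below: "LL T b \<sigma> q (ptime \<gamma>) f \<gamma> \<le> LL T b \<sigma> q 0 v \<gamma>"
    if "\<gamma> \<in> Lam T 0" "ptime \<gamma> < T" "f \<in> test_below T \<gamma> v" for \<gamma> f
    by (rule LL_mono_of_contact[OF assms(2) that(1,2) test_belowD(1)[OF that(3)] order_refl v
          ptime_nonneg test_belowD(2)[OF that(3), symmetric] test_belowD(3)[OF that(3)]])
  have self: "LL T b \<sigma> q (ptime \<gamma>) v \<gamma> = LL T b \<sigma> q 0 v \<gamma>" if "\<gamma> \<in> Lam T 0" "ptime \<gamma> < T" for \<gamma>
    using above below C12p_tests_itself[OF v] that by (meson antisym)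
  have sub: "classical_subsolution T b \<sigma> q \<phi> v \<longleftrightarrow> viscosity_subsolution T b \<sigma> q \<phi> v"
  proof -
    have "0 \<le> LL T b \<sigma> q 0 v \<gamma> \<longleftrightarrow> (\<forall>f\<in>test_above T \<gamma> v. 0 \<le> LL T b \<sigma> q (ptime \<gamma>) f \<gamma>)"
      if "\<gamma> \<in> Lam T 0" "ptime \<gamma> < T" for \<gamma>
      using above[OF that] self[OF that] C12p_tests_itself(1)[OF v that(1)] order_trans by metis
    then show ?thesis
      using continuous_on_imp_usc_on[OF cont] v
      unfolding classical_subsolution_def viscosity_subsolution_def by simp
  qed
  have super: "classical_supersolution T b \<sigma> q \<phi> v \<longleftrightarrow> viscosity_supersolution T b \<sigma> q \<phi> v"
  proof -
    have "LL T b \<sigma> q 0 v \<gamma> \<le> 0 \<longleftrightarrow> (\<forall>f\<in>test_below T \<gamma> v. LL T b \<sigma> q (ptime \<gamma>) f \<gamma> \<le> 0)"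
      if "\<gamma> \<in> Lam T 0" "ptime \<gamma> < T" for \<gamma>
      using below[OF that] self[OF that] C12p_tests_itself(2)[OF v that(1)] order_trans by metis
    then show ?thesis
      using continuous_on_imp_lsc_on[OF cont] v
      unfolding classical_supersolution_def viscosity_supersolution_def by simp
  qed
  have "classical_solution T b \<sigma> q \<phi> v \<longleftrightarrow>
      classical_subsolution T b \<sigma> q \<phi> v \<and> classical_supersolution T b \<sigma> q \<phi> v"
    unfolding classical_solution_def classical_subsolution_def classical_supersolution_def
    by (auto intro: antisym)
  with sub super cont show ?thesis
    unfolding viscosity_solution_def by blast
qed

end
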